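(* Let $A\in\{0,1\}$ be a treatment, $Y(1),Y(0)$ real-valued potential outcomes, $U=\{Y(1),Y(0)\}$, $Y=AY(1)+(1-A)Y(0)$, $Z$ a general (possibly vector-valued) instrumental variable and $\Pi=\mathrm{pr}(A=1\mid Z)$, following the causal diagram $Z\to\Pi\to A$, $U\to A$, $U\to Y$, $A\to Y$ described in the context. Suppose that (a') $\mathrm{pr}(A=1\mid\Pi,U)=\Pi\,\delta\{Y(1)\}\,\eta\{Y(0)\}$ with $\delta(\cdot)$ and $\eta(\cdot)$ being non-decreasing; (b) $Y(1)$ and $Y(0)$ have non-negative distributional associations on each other, i.e., $\partial F(y_1\mid y_0)/\partial y_0\le 0$ and $\partial F(y_0\mid y_1)/\partial y_1\le 0$ for all $y_1$ and $y_0$; (c) the essential supremum of $Y(1)$ given $Y(0)$ does not depend on $Y(0)$, and the essential supremum of $Y(0)$ given $Y(1)$ does not depend on $Y(1)$. Then $$\mathrm{ACE}_1^{\mathrm{adj}}\ge \mathrm{ACE}^{\mathrm{unadj}}\ge \mathrm{ACE}_1^{\mathrm{true}},\qquad \mathrm{ACE}_0^{\mathrm{adj}}\ge \mathrm{ACE}^{\mathrm{unadj}}\ge \mathrm{ACE}_0^{\mathrm{true}},\qquad \mathrm{ACE}^{\mathrm{adj}}\ge \mathrm{ACE}^{\mathrm{unadj}}\ge \mathrm{ACE}^{\mathrm{true}}.$$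
   Context: The causal diagram is the directed acyclic graph with arrows $Z\to\Pi$, $\Pi\to A$, $U\to A$, $U\to Y$, $A\to Y$, where $U=\{Y(1),Y(0)\}$. It means: $Z$ (hence $\Pi$) is independent of $\{Y(1),Y(0)\}$; $A$ is conditionally independent of $Z$ given $(\Pi,U)$; and $Y=AY(1)+(1-A)Y(0)$. Everything is conditional on observed covariates, which are suppressed. $F(y_1\mid y_0)=\mathrm{pr}\{Y(1)\le y_1\mid Y(0)=y_0\}$ and $F(y_0\mid y_1)=\mathrm{pr}\{Y(0)\le y_0\mid Y(1)=y_1\}$. A random variable $V$ has a non-negative distributional association on a random variable $W$ if $\partial F(w\mid v)/\partial v\le 0$ for all $v,w$, where $F(w\mid v)=\mathrm{pr}(W\le w\mid V=v)$; for discrete variables partial differentiation is replaced by differencing between adjacent levels. True average causal effects: $\mathrm{ACE}_1^{\mathrm{true}}=E\{Y(1)\mid A=1\}-E\{Y(0)\mid A=1\}$, $\mathrm{ACE}_0^{\mathrm{true}}=E\{Y(1)\mid A=0\}-E\{Y(0)\mid A=0\}$, $\mathrm{ACE}^{\mathrm{true}}=E\{Y(1)\}-E\{Y(0)\}$. Unadjusted estimator: $\mathrm{ACE}^{\mathrm{unadj}}=E(Y\mid A=1)-E(Y\mid A=0)$. Adjusted estimators, with $\nu_a(\pi)=E(Y\mid A=a,\Pi=\pi)$ and $F$ denoting distributions of $\Pi$: $\mathrm{ACE}_1^{\mathrm{adj}}=E(Y\mid A=1)-\int\nu_0(\pi)\,F(d\pi\mid A=1)$, $\mathrm{ACE}_0^{\mathrm{adj}}=\int\nu_1(\pi)\,F(d\pi\mid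 A=0)-E(Y\mid A=0)$, $\mathrm{ACE}^{\mathrm{adj}}=\int\nu_1(\pi)\,F(d\pi)-\int\nu_0(\pi)\,F(d\pi)$. All expectations and conditional quantities appearing are understood to be well defined.
   Formalization: The factors δ{Y(1)} and η{Y(0)} in (a') are additionally assumed to be non-negative almost surely; without this two non-positive non-decreasing factors are allowed and the inequalities can fail. *)

theory Defs
  imports "HOL-Probability.Probability"
begin

definition gen_alg :: "'a measure \<Rightarrow> ('a \<Rightarrow> 'b) \<Rightarrow> 'b measure \<Rightarrow> 'a measure" where
  "gen_alg M X N = vimage_algebra (space M) X N"

definition pr_given :: "'a measure \<Rightarrow> 'a measure \<Rightarrow> 'a set \<Rightarrow> 'a \<Rightarrow> real" where
  "pr_given M G E = real_cond_exp M G (indicator E)"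

definition cond_indep ::
  "'a measure \<Rightarrow> 'a measure \<Rightarrow> 'b measure \<Rightarrow> ('a \<Rightarrow> 'b) \<Rightarrow> 'c measure \<Rightarrow> ('a \<Rightarrow> 'c) \<Rightarrow> bool" where
  "cond_indep M G N1 X1 N2 X2 \<longleftrightarrow>
     (\<forall>B\<in>sets N1. \<forall>C\<in>sets N2. AE \<omega> in M.
        pr_given M G {\<omega>\<in>space M. X1 \<omega> \<in> B \<and> X2 \<omega> \<in> C} \<omega>
        = pr_given M G {\<omega>\<in>space M. X1 \<omega> \<in> B} \<omega> * pr_given M G {\<omega>\<in>space M. X2 \<omega> \<in> C} \<omega>)"

text \<open>\<open>K\<close> is a regular conditional distribution of \<open>W\<close> given \<open>V\<close>; in particular
  \<open>F(w | v)\<close> is \<open>cdf (K v) w\<close>.\<close>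

definition is_cond_distr ::
  "'a measure \<Rightarrow> ('a \<Rightarrow> real) \<Rightarrow> ('a \<Rightarrow> real) \<Rightarrow> (real \<Rightarrow> real measure) \<Rightarrow> bool" where
  "is_cond_distr M W V K \<longleftrightarrow>
     K \<in> borel \<rightarrow>\<^sub>M prob_algebra borel \<and>
     (\<forall>B\<in>sets borel. AE \<omega> in M.
        measure (K (V \<omega>)) B = pr_given M (gen_alg M V borel) {\<omega>\<in>space M. W \<omega> \<in> B} \<omega>)"

text \<open>Non-negative distributional association of \<open>V\<close> on \<open>W\<close>: \<open>\<partial>F(w | v)/\<partial>v \<le> 0\<close>, with
  differencing between adjacent levels in the discrete case. \<open>S\<close> is the set of levels of \<open>V\<close>.
  If \<open>S\<close> is an interval, it has no adjacent levels and only the derivative condition remains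
  (one-sided at an endpoint); if \<open>S\<close> consists of isolated levels, only the differences remain.
  Variables of mixed type are covered by combining both. The closedness condition says that \<open>S\<close>
  can only fail to be closed at its two ends. It holds for every interval; for isolated
  levels it says that only finitely many lie between any two of them, without which (think of the
  rationals) differences between adjacent levels would carry no information.\<close>

definition nonneg_distr_assoc :: "'a measure \<Rightarrow> ('a \<Rightarrow> real) \<Rightarrow> ('a \<Rightarrow> real) \<Rightarrow> bool" where
  "nonneg_distr_assoc M V W \<longleftrightarrow>
     (\<exists>K S. is_cond_distr M W V K \<and>
        (AE \<omega> in M. V \<omega> \<in> S) \<and>
        (\<forall>a\<in>S. \<forall>b\<in>S. closed (S \<inter> {a..b})) \<and>
        (\<forall>w. \<forall>v\<in>S. v islimpt S \<longrightarrow>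
           (\<exists>D. ((\<lambda>v. cdf (K v) w) has_real_derivative D) (at v within S) \<and> D \<le> 0)) \<and>
        (\<forall>w. \<forall>v\<in>S. \<forall>v'\<in>S. v < v' \<and> S \<inter> {v<..<v'} = {} \<longrightarrow>
           cdf (K v') w - cdf (K v) w \<le> 0))"

text \<open>The essential supremum, possibly infinite, of \<open>W\<close> given \<open>V\<close> does not depend on \<open>V\<close>.\<close>

definition esssup_free_of :: "'a measure \<Rightarrow> ('a \<Rightarrow> real) \<Rightarrow> ('a \<Rightarrow> real) \<Rightarrow> bool" where
  "esssup_free_of M W V \<longleftrightarrow>
     (\<exists>K c. is_cond_distr M W V K \<and> (AE \<omega> in M. esssup (K (V \<omega>)) ereal = c))"

definition given :: "'a measure \<Rightarrow> ('a \<Rightarrow> real) \<Rightarrow> real \<Rightarrow> 'a measure" where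
  "given M A a = uniform_measure M {\<omega>\<in>space M. A \<omega> = a}"

text \<open>\<open>\<nu>\<close> is a version of \<open>\<pi> \<mapsto> E(Y | A = a, \<Pi> = \<pi>)\<close>.\<close>

definition is_outcome_regression ::
  "'a measure \<Rightarrow> ('a \<Rightarrow> real) \<Rightarrow> real \<Rightarrow> ('a \<Rightarrow> real) \<Rightarrow> ('a \<Rightarrow> real) \<Rightarrow> (real \<Rightarrow> real) \<Rightarrow> bool" where
  "is_outcome_regression M A a P Y \<nu> \<longleftrightarrow>
     \<nu> \<in> borel_measurable borel \<and>
     (AE \<omega> in given M A a.
        \<nu> (P \<omega>) = real_cond_exp (given M A a) (gen_alg M P borel) Y \<omega>)"

definition ACE1_true where
  "ACE1_true M A Y1 Y0 = (\<integral>\<omega>. Y1 \<omega> \<partial>given M A 1) - (\<integral>\<omega>. Y0 \<omega> \<partial>given M A 1 :: real)"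

definition ACE0_true where
  "ACE0_true M A Y1 Y0 = (\<integral>\<omega>. Y1 \<omega> \<partial>given M A 0) - (\<integral>\<omega>. Y0 \<omega> \<partial>given M A 0 :: real)"

definition ACE_true where
  "ACE_true M Y1 Y0 = (\<integral>\<omega>. Y1 \<omega> \<partial>M) - (\<integral>\<omega>. Y0 \<omega> \<partial>M :: real)"

definition ACE_unadj where
  "ACE_unadj M A Y = (\<integral>\<omega>. Y \<omega> \<partial>given M A 1) - (\<integral>\<omega>. Y \<omega> \<partial>given M A 0 :: real)"

definition ACE1_adj where
  "ACE1_adj M A P Y \<nu>0 =
     (\<integral>\<omega>. Y \<omega> \<partial>given M A 1) - (\<integral>p. \<nu>0 p \<partial>distr (given M A 1) borel P :: real)"

definition ACE0_adj where
  "ACE0_adj M A P Y \<nu>1 =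
     (\<integral>p. \<nu>1 p \<partial>distr (given M A 0) borel P) - (\<integral>\<omega>. Y \<omega> \<partial>given M A 0 :: real)"

definition ACE_adj where
  "ACE_adj M P \<nu>1 \<nu>0 =
     (\<integral>p. \<nu>1 p \<partial>distr M borel P) - (\<integral>p. \<nu>0 p \<partial>distr M borel P :: real)"

end

theory Submission
  imports Defs
begin

text \<open>
  Write \<open>g = \<delta>(Y(1)) \<eta>(Y(0))\<close>, \<open>e\<^sub>a = E Y(a)\<close>, \<open>m\<^sub>a = E(g Y(a))\<close> and \<open>\<mu> = pr(A = 1) = E \<Pi>\<close>.
  Since \<open>\<Pi>\<close> is independent of \<open>U\<close> and \<open>pr(A = 1 | \<Pi>, U) = \<Pi> g\<close>, comparing \<open>E A = E \<Pi>\<close> with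
  \<open>E A = E \<Pi> \<cdot> E g\<close> gives \<open>E g = 1\<close>, and all quantities in the theorem become functions of
  \<open>e\<^sub>a\<close>, \<open>m\<^sub>a\<close>, \<open>\<mu>\<close> and \<open>\<Pi>\<close>: \<open>E(Y | A = 1) = m\<^sub>1\<close>, \<open>E(Y | A = 0) = (e\<^sub>0 - \<mu> m\<^sub>0) / (1 - \<mu>)\<close>,
  \<open>\<nu>\<^sub>1(\<Pi>) = m\<^sub>1\<close> and \<open>\<nu>\<^sub>0(\<Pi>) = (e\<^sub>0 - \<Pi> m\<^sub>0) / (1 - \<Pi>)\<close>. Given \<open>e\<^sub>a \<le> m\<^sub>a\<close>, the lower
  bounds are elementary and the upper bounds follow from Jensen's inequality for \<open>1 / (1 - \<Pi>)\<close>.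

  To see \<open>e\<^sub>1 \<le> m\<^sub>1\<close>, condition on \<open>Y(1)\<close>: association makes \<open>E(\<eta>(Y(0)) | Y(1))\<close> a
  non-decreasing function of \<open>Y(1)\<close>, so \<open>E(g | Y(1))\<close> is one as well, and Chebyshev's covariance
  inequality applies; \<open>e\<^sub>0 \<le> m\<^sub>0\<close> is symmetric.
\<close>

subsection \<open>Monotonicity and stochastic order\<close>

text \<open>This turns the local form of association, given by derivatives and adjacent differences,
  into a global comparison along the levels \<open>S\<close>. It is applied to
  \<open>cdf (K v) w\<close> as a function of \<open>v\<close>.\<close>

lemma le_of_deriv_nonpos_or_gap:
  fixes f :: "real \<Rightarrow> real"
  assumes closed: "\<And>a b. a \<in> S \<Longrightarrow> b \<in> S \<Longrightarrow> closed (S \<inter> {a..b})"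
    and deriv: "\<And>v. v \<in> S \<Longrightarrow> v islimpt S \<Longrightarrow>
      \<exists>D. (f has_real_derivative D) (at v within S) \<and> D \<le> 0"
    and gap: "\<And>v v'. v \<in> S \<Longrightarrow> v' \<in> S \<Longrightarrow> v < v' \<Longrightarrow> S \<inter> {v<..<v'} = {} \<Longrightarrow> f v' \<le> f v"
    and ab: "a \<in> S" "b \<in> S" "a \<le> b"
  shows "f b \<le> f a"
proof -
  \<comment> \<open>The points up to which the bound with slope \<open>e\<close> holds have a last element \<open>c\<close>. If \<open>c < b\<close>, the
    bound extends beyond \<open>c\<close>: by the derivative if \<open>S\<close> accumulates at \<open>c\<close> from the right, and to
    the next level of \<open>S\<close> otherwise.\<close>
  have "f b \<le> f a + e * (b - a)" if e: "e > 0" for e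
  proof -
    define X where "X = {x \<in> S \<inter> {a..b}. f x \<le> f a + e * (x - a)}"
    define c where "c = Sup X"
    have X: "a \<in> X" "X \<subseteq> S \<inter> {a..b}" "bdd_above X"
      using ab by (auto simp: X_def intro!: bdd_aboveI[of _ b])
    have c_cl: "c \<in> closure X"
      unfolding c_def using X by (intro closure_contains_Sup) auto
    then have cT: "c \<in> S" "a \<le> c" "c \<le> b"
      using closure_minimal[OF X(2) closed[OF ab(1,2)]] by auto
    \<comment> \<open>A supremum missing from \<open>X\<close> would be a limit point of
      \<open>X\<close>, hence of \<open>S\<close>. The derivative there makes \<open>f\<close>
      continuous within \<open>S\<close>, so the bound passes to the limit.\<close>
    have cX: "c \<in> X"
    proof (rule ccontr)
      assume nc: "c \<notin> X"
      with c_cl have lim: "c islimpt X" by (simp add: closure_def)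
      then have "c islimpt S" using X(2) islimpt_subset by blast
      then obtain D where "(f has_real_derivative D) (at c within S)"
        using deriv cT(1) by blast
      then have "(f \<longlongrightarrow> f c) (at c within X)"
        using X(2) by (meson DERIV_continuous continuous_within inf.boundedE tendsto_within_subset)
      then have "f c \<le> f a + e * (c - a)"
      proof (rule tendsto_le[rotated 2])
        show "at c within X \<noteq> bot" using lim by (simp add: trivial_limit_within)
        show "((\<lambda>x. f a + e * (x - a)) \<longlongrightarrow> f a + e * (c - a)) (at c within X)"
          by (intro tendsto_intros)
        show "\<forall>\<^sub>F x in at c within X. f x \<le> f a + e * (x - a)"
          by (auto simp: eventually_at_filter X_def)
      qed
      with nc cT show False by (simp add: X_def)
    qed
    have noX: "x \<notin> X" if "c < x" for x
      using that cSup_upper[OF _ X(3), of x] by (auto simp: c_def)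
    have "c = b"
    proof (rule ccontr)
      assume "c \<noteq> b"
      with cT have cb: "c < b" by simp
      show False
      proof (cases "c islimpt (S \<inter> {c<..})")
        case True
        then have "c islimpt S" using islimpt_subset by blast
        then obtain D where D: "(f has_real_derivative D) (at c within S)" "D \<le> 0"
          using deriv cT(1) by blast
        have "((\<lambda>x. (f x - f c) / (x - c)) \<longlongrightarrow> D) (at c within (S \<inter> {c<..}))"
          using D(1) unfolding has_field_derivative_iff
          by (rule tendsto_within_subset) auto
        then have "\<forall>\<^sub>F x in at c within (S \<inter> {c<..}). (f x - f c) / (x - c) < e"
          using order_tendstoD(2)[of _ D _ e] D(2) e by simp
        moreover have "\<forall>\<^sub>F x in at c within (S \<inter> {c<..}). x < b"
          using cb by (intro order_tendstoD(2)[of _ c]) (auto intro: tendsto_ident_at)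
        moreover have "\<forall>\<^sub>F x in at c within (S \<inter> {c<..}). x \<in> S \<inter> {c<..}"
          by (auto simp: eventually_at_filter)
        moreover have "at c within (S \<inter> {c<..}) \<noteq> bot"
          using True by (simp add: trivial_limit_within)
        ultimately have "\<exists>x. (f x - f c) / (x - c) < e \<and> x < b \<and> x \<in> S \<inter> {c<..}"
          by (intro eventually_happens'[where F = "at c within (S \<inter> {c<..})"] eventually_conj) auto
        then obtain x where x: "(f x - f c) / (x - c) < e" "x < b" "x \<in> S" "c < x" by auto
        then have "f x \<le> f c + e * (x - c)" by (simp add: field_simps)
        with cX x cT have "x \<in> X" by (simp add: X_def algebra_simps)
        with noX x(4) show False by blast
      next
        case False
        \<comment> \<open>No level lies strictly between \<open>c\<close> and \<open>c + d\<close>,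
          so \<open>R\<close> collects all levels of \<open>{a..b}\<close> beyond \<open>c\<close>.
          It is closed, and its least element \<open>c'\<close> is the level adjacent to
          \<open>c\<close>.\<close>
        then obtain d where d: "d > 0" "\<And>x. x \<in> S \<Longrightarrow> c < x \<Longrightarrow> c + d \<le> x"
          unfolding islimpt_approachable by (auto simp: dist_real_def) force
        define R where "R = S \<inter> {a..b} \<inter> {c + d..}"
        define c' where "c' = Inf R"
        have bR: "b \<in> R" using ab cb d by (auto simp: R_def)
        have bb: "bdd_below R" by (auto simp: R_def intro!: bdd_belowI[of _ a])
        have c'R: "c' \<in> R"
          unfolding c'_def using bR bb closed[OF ab(1,2)]
          by (intro closed_contains_Inf) (auto simp: R_def)
        have "x \<notin> S \<inter> {c<..<c'}" for x
        proof
          assume x: "x \<in> S \<inter> {c<..<c'}"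
          with c'R d(2)[of x] cT have "x \<in> R" by (auto simp: R_def)
          with x cInf_lower[OF _ bb, of x] show False by (auto simp: c'_def)
        qed
        moreover have cc': "c < c'" "c' \<in> S" using c'R d(1) by (auto simp: R_def)
        ultimately have "f c' \<le> f c" using cT(1) by (intro gap) auto
        moreover have "e * (c - a) \<le> e * (c' - a)" using e cc' by simp
        ultimately have "c' \<in> X" using cX c'R by (auto simp: X_def R_def)
        with noX cc' show False by blast
      qed
    qed
    with cX show ?thesis by (simp add: X_def)
  qed note * = this
  show ?thesis
  proof (cases "a = b")
    case False
    show ?thesis
    proof (rule field_le_epsilon)
      fix e :: real assume "e > 0"
      with *[of "e / (b - a)"] False ab show "f b \<le> f a + e" by simp
    qed
  qed simp
qed

text \<open>The infimum is the only possible end point, and it either belongs to the set or does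
  not. The case split yields measurability of upper sets and reduces comparisons of measures to
  half-lines.\<close>

lemma upper_set_cases:
  fixes U :: "real set"
  assumes U: "\<And>x y. x \<in> U \<Longrightarrow> x \<le> y \<Longrightarrow> y \<in> U"
  obtains "U = {}" | "U = UNIV" | w where "U = {w..}" | w where "U = {w<..}"
proof -
  have "U = UNIV" if "\<not> bdd_below U"
  proof -
    have "x \<in> U" for x
      using that U unfolding bdd_below_def by (meson linear)
    then show ?thesis by blast
  qed
  moreover have "U = {Inf U..} \<or> U = {Inf U<..}" if "bdd_below U" "U \<noteq> {}"
  proof -
    have "x \<in> U" if "Inf U < x" for x
      using \<open>bdd_below U\<close> \<open>U \<noteq> {}\<close> that U by (meson cInf_less_iff less_imp_le)
    moreover have "Inf U \<le> x" if "x \<in> U" for x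
      using \<open>bdd_below U\<close> that by (simp add: cInf_lower)
    ultimately show ?thesis
      by (cases "Inf U \<in> U") (auto simp: less_le)
  qed
  ultimately show ?thesis using that by metis
qed

text \<open>First-order stochastic dominance: a smaller cdf leaves more mass on every right
  half-line, and any other upper set is trivial.\<close>

lemma measure_upper_set_mono:
  fixes U :: "real set"
  assumes "real_distribution M" "real_distribution N"
    and le: "\<And>w. cdf N w \<le> cdf M w"
    and U: "\<And>x y. x \<in> U \<Longrightarrow> x \<le> y \<Longrightarrow> y \<in> U"
  shows "measure M U \<le> measure N U"
proof -
  interpret M: real_distribution M by fact
  interpret N: real_distribution N by fact
  from U consider "U = {}" | "U = UNIV" | w where "U = {w..}" | w where "U = {w<..}"
    by (rule upper_set_cases)
  then show ?thesis
  proof cases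
    case 2
    then show ?thesis using M.prob_space N.prob_space by simp
  next
    case (3 w)
    \<comment> \<open>The complement of \<open>{w..}\<close> is an open half-line, whose measure is
      the left limit of the cdf at \<open>w\<close>; the order of the cdfs survives this
      limit.\<close>
    have "measure N {..<w} \<le> measure M {..<w}"
      by (rule tendsto_le[OF _ M.cdf_at_left N.cdf_at_left]) (auto simp: le)
    moreover have "- {w..} = {..<w}" by auto
    ultimately show ?thesis
      using M.prob_compl[of "{..<w}"] N.prob_compl[of "{..<w}"] 3
      by (simp add: Compl_eq_Diff_UNIV[symmetric] Compl_lessThan)
  next
    case (4 w)
    then show ?thesis
      using M.prob_compl[of "{..w}"] N.prob_compl[of "{..w}"] le[of w]
      by (simp add: Compl_eq_Diff_UNIV[symmetric] Compl_atMost cdf_def)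
  qed simp
qed

subsection \<open>Covariance of associated variables\<close>

text \<open>The product of \<open>X - m\<close> and \<open>h (X) - c\<close> is almost surely
  non-negative, since both factors change sign at the mean \<open>m\<close>. Its expectation is the
  covariance, because \<open>X - m\<close> has mean zero and the constant \<open>c\<close> drops
  out.\<close>

lemma (in prob_space) expectation_Chebyshev:
  fixes X :: "'a \<Rightarrow> real" and h :: "real \<Rightarrow> real"
  assumes X: "integrable M X" and h: "integrable M (\<lambda>\<omega>. h (X \<omega>))"
    and Xh: "integrable M (\<lambda>\<omega>. X \<omega> * h (X \<omega>))"
    and S: "AE \<omega> in M. X \<omega> \<in> S" and mono: "mono_on S h"
  shows "expectation X * expectation (\<lambda>\<omega>. h (X \<omega>)) \<le> expectation (\<lambda>\<omega>. X \<omega> * h (X \<omega>))"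
proof -
  define m where "m = expectation X"
  \<comment> \<open>The number \<open>c\<close> stands in for \<open>h m\<close>, as the mean
    \<open>m\<close> may lie outside \<open>S\<close>.\<close>
  define c where "c = Sup (h ` (S \<inter> {..m}))"
  \<comment> \<open>Levels on both sides of the mean make the set under the supremum non-empty and
    bounded above by \<open>h v2\<close>.\<close>
  have "\<exists>v\<in>S. v \<le> m"
  proof (rule ccontr)
    assume "\<not> ?thesis"
    then have "AE \<omega> in M. m < X \<omega>" using S by (auto simp: not_le elim: eventually_mono)
    then have "m < expectation X" using expectation_greater[OF X] by blast
    then show False by (simp add: m_def)
  qed
  moreover have "\<exists>v\<in>S. m \<le> v"
  proof (rule ccontr)
    assume "\<not> ?thesis"
    then have "AE \<omega> in M. X \<omega> < m" using S by (auto simp: not_le elim: eventually_mono)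
    then have "expectation X < m" using expectation_less[OF X] by blast
    then show False by (simp add: m_def)
  qed
  ultimately obtain v1 v2 where v: "v1 \<in> S" "v1 \<le> m" "v2 \<in> S" "m \<le> v2" by blast
  have bdd: "bdd_above (h ` (S \<inter> {..m}))"
    using v mono by (auto intro!: bdd_aboveI[of _ "h v2"] simp: mono_on_def)
  have pos: "0 \<le> (v - m) * (h v - c)" if "v \<in> S" for v
  proof (cases "v \<le> m")
    case True
    then have "h v \<le> c" unfolding c_def using that bdd by (intro cSup_upper) auto
    with True show ?thesis by (simp add: mult_nonpos_nonpos)
  next
    case False
    then have "c \<le> h v" unfolding c_def using that v mono
      by (intro cSup_least) (auto simp: mono_on_def)
    with False show ?thesis by simp
  qed
  have "0 \<le> expectation (\<lambda>\<omega>. (X \<omega> - m) * (h (X \<omega>) - c))"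
    using S pos by (intro integral_nonneg_AE) auto
  also have "\<dots> = expectation (\<lambda>\<omega>. X \<omega> * h (X \<omega>) - m * h (X \<omega>) - c * X \<omega> + c * m)"
    by (simp add: algebra_simps)
  also have "\<dots> = expectation (\<lambda>\<omega>. X \<omega> * h (X \<omega>)) - m * expectation (\<lambda>\<omega>. h (X \<omega>))"
    using X h Xh by (simp add: m_def prob_space)
  finally show ?thesis by (simp add: m_def)
qed

section \<open>Conditioning on a generated sigma-algebra\<close>

lemma subalgebra_gen_alg:
  assumes "X \<in> M \<rightarrow>\<^sub>M N"
  shows "subalgebra M (gen_alg M X N)"
  using assms by (auto simp: subalgebra_def gen_alg_def measurable_iff_sets)

lemma measurable_gen_alg:
  assumes "X \<in> M \<rightarrow>\<^sub>M N"
  shows "X \<in> gen_alg M X N \<rightarrow>\<^sub>M N"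
  unfolding gen_alg_def using assms by (intro measurable_vimage_algebra1) (auto simp: measurable_def)

lemma (in finite_measure) sigma_finite_subalgebraI:
  assumes "subalgebra M F"
  shows "sigma_finite_subalgebra M F"
proof -
  interpret finite_measure_subalgebra M F using assms by unfold_locales
  show ?thesis by unfold_locales
qed

text \<open>The defining property of a conditional probability, for an arbitrary version
  \<open>q\<close> and a test function that need only be integrable on \<open>E\<close>. It serves
  for kernels, for the selection probability and for the propensity.\<close>

lemma (in prob_space) expectation_mult_pr_given:
  fixes h q :: "'a \<Rightarrow> real"
  assumes F: "subalgebra M F" and h: "h \<in> borel_measurable F"
    and E: "E \<in> sets M" and q [measurable]: "q \<in> borel_measurable M"
    and eq: "AE \<omega> in M. pr_given M F E \<omega> = q \<omega>"
    and int: "integrable M (\<lambda>\<omega>. h \<omega> * indicator E \<omega>)"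
  shows "integrable M (\<lambda>\<omega>. h \<omega> * q \<omega>)"
    and "expectation (\<lambda>\<omega>. h \<omega> * q \<omega>) = expectation (\<lambda>\<omega>. h \<omega> * indicator E \<omega>)"
proof -
  interpret sigma_finite_subalgebra M F using F by (rule sigma_finite_subalgebraI)
  have [measurable]: "h \<in> borel_measurable M" using F h by (rule measurable_from_subalg)
  note r = real_cond_exp_intg[OF int h borel_measurable_indicator[OF E]]
  have ae: "AE \<omega> in M. h \<omega> * real_cond_exp M F (indicator E) \<omega> = h \<omega> * q \<omega>"
    using eq by eventually_elim (simp add: pr_given_def)
  show "integrable M (\<lambda>\<omega>. h \<omega> * q \<omega>)"
    by (subst integrable_cong_AE[OF _ _ ae, symmetric]) (use r in measurable)
  show "expectation (\<lambda>\<omega>. h \<omega> * q \<omega>) = expectation (\<lambda>\<omega>. h \<omega> * indicator E \<omega>)"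
    by (subst integral_cong_AE[OF _ _ ae, symmetric]) (use r in measurable)
qed

text \<open>Conditioning on \<open>V\<close> replaces the indicator by the kernel mass
  \<open>k (V)\<close> of \<open>U\<close>. Association orders the kernels stochastically, so
  \<open>k\<close> is non-decreasing on the levels, and Chebyshev's inequality applies to
  \<open>d * k\<close>. Integrability is assumed for the products, as \<open>d (V)\<close> alone may
  fail to be integrable.\<close>

lemma (in prob_space) expectation_mult_upper_set:
  fixes V W :: "'a \<Rightarrow> real"
  assumes V: "integrable M V" and W [measurable]: "W \<in> borel_measurable M"
    and assoc: "nonneg_distr_assoc M V W"
    and d: "mono d" "AE \<omega> in M. 0 \<le> d (V \<omega>)"
    and U: "\<And>x y. x \<in> U \<Longrightarrow> x \<le> y \<Longrightarrow> y \<in> U"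
    and int1: "integrable M (\<lambda>\<omega>. d (V \<omega>) * indicator U (W \<omega>))"
    and int2: "integrable M (\<lambda>\<omega>. V \<omega> * (d (V \<omega>) * indicator U (W \<omega>)))"
  shows "expectation V * expectation (\<lambda>\<omega>. d (V \<omega>) * indicator U (W \<omega>))
    \<le> expectation (\<lambda>\<omega>. V \<omega> * (d (V \<omega>) * indicator U (W \<omega>)))"
proof -
  have [measurable]: "V \<in> borel_measurable M" using V by simp
  have [measurable]: "d \<in> borel_measurable borel" using d(1) by (rule borel_measurable_mono)
  have [measurable]: "U \<in> sets borel" using U by (rule upper_set_cases) auto
  define F where "F = gen_alg M V borel"
  have sub: "subalgebra M F" unfolding F_def by (rule subalgebra_gen_alg) measurable
  have VF [measurable]: "V \<in> borel_measurable F"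
    unfolding F_def by (rule measurable_gen_alg) measurable
  define E where "E = {\<omega> \<in> space M. W \<omega> \<in> U}"
  have [measurable]: "E \<in> sets M" unfolding E_def by measurable
  obtain K S where K: "is_cond_distr M W V K"
    and S: "AE \<omega> in M. V \<omega> \<in> S" "\<And>a b. a \<in> S \<Longrightarrow> b \<in> S \<Longrightarrow> closed (S \<inter> {a..b})"
    and deriv: "\<And>w v. v \<in> S \<Longrightarrow> v islimpt S \<Longrightarrow>
      \<exists>D. ((\<lambda>v. cdf (K v) w) has_real_derivative D) (at v within S) \<and> D \<le> 0"
    and gap: "\<And>w v v'. v \<in> S \<Longrightarrow> v' \<in> S \<Longrightarrow> v < v' \<Longrightarrow> S \<inter> {v<..<v'} = {} \<Longrightarrow>
      cdf (K v') w - cdf (K v) w \<le> 0"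
    using assoc unfolding nonneg_distr_assoc_def by metis
  have Kp: "K \<in> borel \<rightarrow>\<^sub>M prob_algebra borel" using K by (simp add: is_cond_distr_def)
  then have [measurable]: "K \<in> borel \<rightarrow>\<^sub>M subprob_algebra borel"
    by (rule measurable_prob_algebraD)
  have Kd: "real_distribution (K v)" for v
    using measurable_space[OF Kp, of v]
    by (auto simp: space_prob_algebra real_distribution_def real_distribution_axioms_def)
  define k where "k v = measure (K v) U" for v
  have k_meas [measurable]: "k \<in> borel_measurable borel" unfolding k_def by measurable
  have k_eq: "AE \<omega> in M. pr_given M F E \<omega> = k (V \<omega>)"
  proof -
    have "AE \<omega> in M. measure (K (V \<omega>)) U = pr_given M F E \<omega>"
      using K \<open>U \<in> sets borel\<close> unfolding is_cond_distr_def F_def E_def by blast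
    then show ?thesis by eventually_elim (simp add: k_def)
  qed
  have ind: "indicator U (W \<omega>) = (indicator E \<omega> :: real)" if "\<omega> \<in> space M" for \<omega>
    using that by (auto simp: E_def indicator_def)
  \<comment> \<open>The weight \<open>f\<close> is kept general, since both \<open>d v\<close> and
    \<open>v * d v\<close> are needed.\<close>
  have *: "integrable M (\<lambda>\<omega>. f (V \<omega>) * k (V \<omega>)) \<and>
      expectation (\<lambda>\<omega>. f (V \<omega>) * k (V \<omega>)) = expectation (\<lambda>\<omega>. f (V \<omega>) * indicator U (W \<omega>))"
    if f: "integrable M (\<lambda>\<omega>. f (V \<omega>) * indicator U (W \<omega>))"
      and [measurable]: "f \<in> borel_measurable borel" for f :: "real \<Rightarrow> real"
  proof -
    have "integrable M (\<lambda>\<omega>. f (V \<omega>) * indicator E \<omega>)"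
      using f by (simp add: ind cong: Bochner_Integration.integrable_cong)
    from expectation_mult_pr_given[OF sub _ \<open>E \<in> sets M\<close> _ k_eq this] show ?thesis
      by (simp add: ind cong: Bochner_Integration.integral_cong)
  qed
  have k_mono: "k v \<le> k v'" if "v \<in> S" "v' \<in> S" "v \<le> v'" for v v'
    unfolding k_def
  proof (rule measure_upper_set_mono[OF Kd Kd _ U])
    show "cdf (K v') w \<le> cdf (K v) w" for w
      using gap by (intro le_of_deriv_nonpos_or_gap[OF S(2) deriv _ that]) auto
  qed
  \<comment> \<open>The sign of \<open>d\<close> is known only almost surely along \<open>V\<close>,
    so the product is claimed to be monotone only on levels where \<open>d\<close> is
    non-negative.\<close>
  have m: "mono_on {v \<in> S. 0 \<le> d v} (\<lambda>v. d v * k v)"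
    using k_mono d(1) by (auto simp: mono_on_def mono_def k_def intro!: mult_mono)
  note i1 = *[of d, OF int1]
  have int2': "integrable M (\<lambda>\<omega>. (V \<omega> * d (V \<omega>)) * indicator U (W \<omega>))"
    using int2 by (simp add: mult.assoc)
  note i2 = *[of "\<lambda>v. v * d v", OF int2']
  have "expectation V * expectation (\<lambda>\<omega>. d (V \<omega>) * k (V \<omega>))
    \<le> expectation (\<lambda>\<omega>. V \<omega> * (d (V \<omega>) * k (V \<omega>)))"
    by (rule expectation_Chebyshev[OF V _ _ _ m]) (use i1 i2 S(1) d(2) in \<open>auto simp: mult.assoc\<close>)
  then show ?thesis using i1 i2 by (simp add: mult.assoc)
qed

text \<open>The sum counts the grid points \<open>k / Suc n\<close> in the interval from 0 to
  \<open>y\<close>, starting at \<open>k = 1\<close>. Hence \<open>s\<close> is \<open>y\<close>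
  rounded down to the grid and capped at \<open>Suc n\<close>.\<close>

lemma staircase_approx:
  fixes y :: real and n :: nat
  assumes "0 \<le> y"
  defines "s \<equiv> (\<Sum>k = 1..Suc n ^ 2. indicator {real k / Suc n..} y / Suc n)"
  shows "0 \<le> s" "s \<le> y" "y \<le> Suc n \<Longrightarrow> y - 1 / Suc n \<le> s"
proof -
  define N where "N = min (nat \<lfloor>Suc n * y\<rfloor>) (Suc n ^ 2)"
  have "s = (\<Sum>k = 1..Suc n ^ 2. indicator {..N} k) / Suc n"
    unfolding s_def sum_divide_distrib
  proof (rule sum.cong)
    fix k assume "k \<in> {1..Suc n ^ 2}"
    have "real k / Suc n \<le> y \<longleftrightarrow> real k \<le> Suc n * y" by (simp add: field_simps)
    also have "\<dots> \<longleftrightarrow> k \<le> nat \<lfloor>Suc n * y\<rfloor>" using assms(1) by (simp add: le_nat_iff le_floor_iff)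
    finally show "indicator {real k / Suc n..} y / Suc n = (indicator {..N} k :: real) / Suc n"
      using \<open>k \<in> _\<close> by (auto simp: N_def indicator_def)
  qed simp
  also have "(\<Sum>k = 1..Suc n ^ 2. indicator {..N} k) = real N"
  proof -
    have "(\<Sum>k = 1..Suc n ^ 2. indicator {..N} k) = (\<Sum>k = 1..N. 1 :: real)"
      by (rule sum.mono_neutral_cong_right) (auto simp: N_def indicator_def)
    then show ?thesis by simp
  qed
  finally have s: "s = N / Suc n" .
  show "0 \<le> s" by (simp add: s)
  have "real N \<le> Suc n * y" proof -
    have "real N \<le> real (nat \<lfloor>Suc n * y\<rfloor>)" unfolding N_def of_nat_le_iff by simp
    also have "\<dots> \<le> Suc n * y" using assms(1) by (intro of_nat_floor) simp
    finally show ?thesis .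
  qed
  then show "s \<le> y" by (simp add: s field_simps)
  show "y - 1 / Suc n \<le> s" if "y \<le> Suc n"
  proof -
    \<comment> \<open>As \<open>N\<close> is a minimum, both of its arguments are bounded below: the
      cap through \<open>y \<le> Suc n\<close>, the floor by its rounding error.\<close>
    have "Suc n * y - 1 \<le> real (Suc n ^ 2)" proof -
      have "Suc n * y \<le> real (Suc n) * Suc n" using that by (intro mult_left_mono) auto
      then show ?thesis by (simp only: of_nat_mult power2_eq_square)
    qed
    moreover have "Suc n * y - 1 \<le> real (nat \<lfloor>Suc n * y\<rfloor>)" using assms(1) by linarith
    ultimately have "Suc n * y - 1 \<le> N" by (simp add: N_def min_def del: of_nat_Suc of_nat_power)
    then have "(Suc n * y - 1) / Suc n \<le> N / Suc n" by (rule divide_right_mono) simp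
    then show ?thesis by (simp add: s diff_divide_distrib del: of_nat_Suc)
  qed
qed


text \<open>This is the source of both \<open>e1 \<le> m1\<close> and \<open>e0 \<le> m0\<close>,
  with \<open>V\<close> and \<open>W\<close> exchanged. The bound \<open>C\<close> on the product
  provides the dominating functions for passing from staircases to \<open>e\<close>.\<close>

lemma (in prob_space) expectation_mult_assoc:
  fixes V W :: "'a \<Rightarrow> real"
  assumes V: "integrable M V" and W [measurable]: "W \<in> borel_measurable M"
    and assoc: "nonneg_distr_assoc M V W"
    and mono: "mono d" "mono e"
    and nonneg: "AE \<omega> in M. 0 \<le> d (V \<omega>) \<and> 0 \<le> e (W \<omega>)"
    and C: "AE \<omega> in M. d (V \<omega>) * e (W \<omega>) \<le> C"
  shows "expectation V * expectation (\<lambda>\<omega>. d (V \<omega>) * e (W \<omega>))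
    \<le> expectation (\<lambda>\<omega>. V \<omega> * (d (V \<omega>) * e (W \<omega>)))"
proof -
  have [measurable]: "V \<in> borel_measurable M" using V by simp
  have [measurable]: "d \<in> borel_measurable borel" "e \<in> borel_measurable borel"
    using mono by (auto intro: borel_measurable_mono)
  \<comment> \<open>Staircases turn \<open>e (W)\<close> into positive combinations of indicators of upper sets, whose
    conditional expectations given \<open>V\<close> can be read off a regular conditional distribution.\<close>
  define f :: "nat \<Rightarrow> nat \<Rightarrow> 'a \<Rightarrow> real"
    where "f n k \<omega> = d (V \<omega>) * indicator {x. real k / Suc n \<le> e x} (W \<omega>)" for n k \<omega>
  define s where "s n y = (\<Sum>k = 1..Suc n ^ 2. indicator {real k / Suc n..} y / Suc n :: real)" for n y
  have [measurable]: "s n \<in> borel_measurable borel" for n unfolding s_def by measurable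
  have f_meas [measurable]: "f n k \<in> borel_measurable M" for n k unfolding f_def by measurable
  have s_f: "d (V \<omega>) * s n (e (W \<omega>)) = (\<Sum>k = 1..Suc n ^ 2. f n k \<omega> / Suc n)" for n \<omega>
    by (auto simp: s_def f_def sum_distrib_left indicator_def intro!: sum.cong)
  have "AE \<omega> in M. 0 \<le> C"
    using nonneg C by eventually_elim (meson mult_nonneg_nonneg order_trans)
  then have C0: "0 \<le> C" by simp
  \<comment> \<open>Only the product of \<open>d (V)\<close> and \<open>e (W)\<close> is bounded. On
    the event in question \<open>e (W)\<close> is at least \<open>1 / Suc n\<close>, because
    \<open>k\<close> starts at 1, and this bounds \<open>d (V)\<close> there.\<close>
  have f_bound: "AE \<omega> in M. norm (f n k \<omega>) \<le> Suc n * C" if "k \<ge> 1" for n k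
    using nonneg C
  proof eventually_elim
    case (elim \<omega>)
    show ?case
    proof (cases "real k / Suc n \<le> e (W \<omega>)")
      case True
      have "1 \<le> real k" using that by simp
      also have "\<dots> \<le> Suc n * e (W \<omega>)" using True by (simp add: field_simps)
      finally have "d (V \<omega>) * 1 \<le> d (V \<omega>) * (Suc n * e (W \<omega>))"
        using elim by (intro mult_left_mono) auto
      also have "\<dots> = Suc n * (d (V \<omega>) * e (W \<omega>))" by simp
      also have "\<dots> \<le> Suc n * C" using elim by (intro mult_left_mono) auto
      finally show ?thesis using elim by (simp add: f_def indicator_def)
    qed (use C0 in \<open>simp add: f_def\<close>)
  qed
  have f_int: "integrable M (f n k)" if "k \<ge> 1" for n k
    using f_bound[OF that] by (intro integrable_const_bound) auto
  have Vf_int: "integrable M (\<lambda>\<omega>. V \<omega> * f n k \<omega>)" if "k \<ge> 1" for n k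
  proof (rule Bochner_Integration.integrable_bound)
    show "integrable M (\<lambda>\<omega>. V \<omega> * (Suc n * C))" using V by simp
    show "AE \<omega> in M. norm (V \<omega> * f n k \<omega>) \<le> norm (V \<omega> * (Suc n * C))"
      using f_bound[OF that, of n] by eventually_elim (use C0 in \<open>simp add: abs_mult mult_left_mono\<close>)
  qed measurable
  have step: "expectation V * expectation (\<lambda>\<omega>. d (V \<omega>) * s n (e (W \<omega>)))
    \<le> expectation (\<lambda>\<omega>. V \<omega> * (d (V \<omega>) * s n (e (W \<omega>))))" for n
  proof -
    have "expectation V * expectation (f n k) \<le> expectation (\<lambda>\<omega>. V \<omega> * f n k \<omega>)" if "k \<ge> 1" for k
      unfolding f_def
    proof (rule expectation_mult_upper_set[OF V W assoc mono(1)])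
      show "AE \<omega> in M. 0 \<le> d (V \<omega>)" using nonneg by eventually_elim simp
      show "y \<in> {x. real k / Suc n \<le> e x}" if "x \<in> {x. real k / Suc n \<le> e x}" "x \<le> y" for x y
        using that monoD[OF mono(2), of x y] by simp
    qed (use f_int[OF that, of n] Vf_int[OF that, of n] in \<open>simp_all add: f_def[abs_def]\<close>)
    then have "(\<Sum>k = 1..Suc n ^ 2. expectation V * expectation (f n k) / Suc n)
      \<le> (\<Sum>k = 1..Suc n ^ 2. expectation (\<lambda>\<omega>. V \<omega> * f n k \<omega>) / Suc n)"
      by (intro sum_mono divide_right_mono) auto
    then show ?thesis
      using f_int Vf_int by (simp add: s_f sum_distrib_left integral_sum)
  qed
  have lim: "AE \<omega> in M. (\<lambda>n. d (V \<omega>) * s n (e (W \<omega>))) \<longlonglongrightarrow> d (V \<omega>) * e (W \<omega>)"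
    using nonneg
  proof eventually_elim
    case (elim \<omega>)
    let ?y = "e (W \<omega>)"
    have "(\<lambda>n. s n ?y) \<longlonglongrightarrow> ?y"
    proof (rule tendsto_sandwich)
      \<comment> \<open>From this index on, \<open>?y\<close> lies below the cap
        \<open>Suc n\<close> of the staircase.\<close>
      have "\<forall>\<^sub>F n in sequentially. n \<ge> nat \<lceil>?y\<rceil>" by (rule eventually_ge_at_top)
      then show "\<forall>\<^sub>F n in sequentially. ?y - 1 / Suc n \<le> s n ?y"
      proof eventually_elim
        case (elim n)
        then have "?y \<le> Suc n" by linarith
        then show ?case
          using staircase_approx(3)[of ?y n] \<open>0 \<le> d (V \<omega>) \<and> 0 \<le> ?y\<close> by (simp add: s_def)
      qed
      show "\<forall>\<^sub>F n in sequentially. s n ?y \<le> ?y"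
        using staircase_approx(2)[of ?y] elim by (simp add: s_def)
      show "(\<lambda>n. ?y - 1 / Suc n) \<longlonglongrightarrow> ?y"
        using tendsto_diff[OF tendsto_const[of ?y] LIMSEQ_inverse_real_of_nat]
        by (simp add: inverse_eq_divide)
    qed simp
    then show ?case by (intro tendsto_intros)
  qed
  have bound: "AE \<omega> in M. norm (d (V \<omega>) * s n (e (W \<omega>))) \<le> C" for n
    using nonneg C
  proof eventually_elim
    case (elim \<omega>)
    have "0 \<le> s n (e (W \<omega>))" "s n (e (W \<omega>)) \<le> e (W \<omega>)"
      using staircase_approx(1,2)[of "e (W \<omega>)" n] elim by (simp_all add: s_def)
    then have "norm (d (V \<omega>) * s n (e (W \<omega>))) \<le> d (V \<omega>) * e (W \<omega>)"
      using elim by (simp add: abs_mult mult_left_mono)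
    with elim show ?case by simp
  qed
  have L1: "(\<lambda>n. expectation (\<lambda>\<omega>. d (V \<omega>) * s n (e (W \<omega>)))) \<longlonglongrightarrow> expectation (\<lambda>\<omega>. d (V \<omega>) * e (W \<omega>))"
    using lim bound by (intro integral_dominated_convergence[where w = "\<lambda>_. C"]) auto
  have L2: "(\<lambda>n. expectation (\<lambda>\<omega>. V \<omega> * (d (V \<omega>) * s n (e (W \<omega>)))))
    \<longlonglongrightarrow> expectation (\<lambda>\<omega>. V \<omega> * (d (V \<omega>) * e (W \<omega>)))"
  proof (rule integral_dominated_convergence[where w = "\<lambda>\<omega>. \<bar>V \<omega>\<bar> * C"])
    show "AE \<omega> in M. (\<lambda>n. V \<omega> * (d (V \<omega>) * s n (e (W \<omega>)))) \<longlonglongrightarrow> V \<omega> * (d (V \<omega>) * e (W \<omega>))"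
      using lim by eventually_elim (rule tendsto_mult_left)
    show "AE \<omega> in M. norm (V \<omega> * (d (V \<omega>) * s n (e (W \<omega>)))) \<le> \<bar>V \<omega>\<bar> * C" for n
      using bound[of n] by eventually_elim (simp add: abs_mult[of "V _"] mult_left_mono)
  qed (use V in \<open>auto intro!: integrable_abs\<close>)
  show ?thesis
    by (rule LIMSEQ_le[OF tendsto_mult_left[OF L1] L2]) (use step in auto)
qed

subsection \<open>Independence, conditioning on events, and regressions\<close>

text \<open>Independence depends only on the joint law. This matters because \<open>P\<close> agrees
  only almost surely with a function measurable with respect to \<open>Z\<close>.\<close>

lemma (in prob_space) indep_var_cong_AE:
  assumes indep: "indep_var S X T Y" and X' [measurable]: "X' \<in> M \<rightarrow>\<^sub>M S"
    and eq: "AE \<omega> in M. X \<omega> = X' \<omega>"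
  shows "indep_var S X' T Y"
proof -
  have [measurable]: "X \<in> M \<rightarrow>\<^sub>M S" "Y \<in> M \<rightarrow>\<^sub>M T"
    using indep by (rule indep_var_rv1, rule indep_var_rv2)
  have "distr M S X' = distr M S X"
    by (rule distr_cong_AE) (use eq in \<open>auto elim!: eventually_mono\<close>)
  moreover have "distr M (S \<Otimes>\<^sub>M T) (\<lambda>\<omega>. (X' \<omega>, Y \<omega>)) = distr M (S \<Otimes>\<^sub>M T) (\<lambda>\<omega>. (X \<omega>, Y \<omega>))"
    by (rule distr_cong_AE) (use eq in \<open>auto elim!: eventually_mono\<close>)
  ultimately show ?thesis
    using indep unfolding indep_var_distribution_eq by simp
qed

lemma (in prob_space) indep_var_subalgebra:
  assumes indep: "indep_set (sets F) (sets G)"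
    and F: "subalgebra M F" and G: "subalgebra M G"
    and X: "X \<in> F \<rightarrow>\<^sub>M S" and Y: "Y \<in> G \<rightarrow>\<^sub>M T"
  shows "indep_var S X T Y"
  unfolding indep_var_eq
proof (intro conjI)
  show "X \<in> M \<rightarrow>\<^sub>M S" using F X by (rule measurable_from_subalg)
  show "Y \<in> M \<rightarrow>\<^sub>M T" using G Y by (rule measurable_from_subalg)
  have *: "sigma_sets (space M) {X -` A \<inter> space M |A. A \<in> sets S} \<subseteq> sets F"
    if F: "subalgebra M F" and X: "X \<in> F \<rightarrow>\<^sub>M S" for F S and X :: "'a \<Rightarrow> 'd"
  proof (rule sets.sigma_sets_subset')
    have sp: "space F = space M" using F by (simp add: subalgebra_def)
    show "{X -` A \<inter> space M |A. A \<in> sets S} \<subseteq> sets F"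
      using measurable_sets[OF X] by (auto simp: sp)
    show "space M \<in> sets F" using sets.top[of F] by (simp add: sp)
  qed
  show "indep_set (sigma_sets (space M) {X -` A \<inter> space M |A. A \<in> sets S})
      (sigma_sets (space M) {Y -` A \<inter> space M |A. A \<in> sets T})"
    using indep *[OF F X] *[OF G Y] unfolding indep_sets2_eq by blast
qed

lemma (in prob_space) integrable_uniform_measure:
  fixes f :: "'a \<Rightarrow> real"
  assumes [measurable]: "E \<in> sets M" and f: "integrable M f" and E: "prob E \<noteq> 0"
  shows "integrable (uniform_measure M E) f"
    and "integral\<^sup>L (uniform_measure M E) f = expectation (\<lambda>\<omega>. indicator E \<omega> * f \<omega>) / prob E"
proof -
  have [measurable]: "f \<in> borel_measurable M" using f by simp
  have "0 < prob E" using E by (simp add: zero_less_measure_iff)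
  then have "indicator E x / emeasure M E = ennreal (indicator E x / prob E)" for x
    by (cases "x \<in> E") (simp_all add: emeasure_eq_measure divide_ennreal flip: ennreal_1)
  then have eq: "uniform_measure M E = density M (\<lambda>x. ennreal (indicator E x / prob E))"
    unfolding uniform_measure_def by simp
  have fi: "integrable M (\<lambda>\<omega>. indicator E \<omega> * f \<omega>)"
    using integrable_mult_indicator[OF assms(1,2)] by simp
  show "integrable (uniform_measure M E) f"
    unfolding eq using integrable_mult_left[OF fi, of "inverse (prob E)"]
    by (subst integrable_density) (auto simp: field_simps)
  show "integral\<^sup>L (uniform_measure M E) f = expectation (\<lambda>\<omega>. indicator E \<omega> * f \<omega>) / prob E"
    unfolding eq by (subst integral_density) (auto simp: field_simps)
qed

text \<open>Test with the set where \<open>q\<close> exceeds \<open>r\<close>: the difference is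
  non-negative there and integrates to zero.\<close>

lemma (in prob_space) AE_le_of_set_integrals:
  fixes q r :: "real \<Rightarrow> real"
  assumes [measurable]: "X \<in> borel_measurable M" "q \<in> borel_measurable borel" "r \<in> borel_measurable borel"
    and int: "integrable M (\<lambda>\<omega>. q (X \<omega>))" "integrable M (\<lambda>\<omega>. r (X \<omega>))"
    and eq: "\<And>B. B \<in> sets borel \<Longrightarrow>
      expectation (\<lambda>\<omega>. indicator B (X \<omega>) * q (X \<omega>)) = expectation (\<lambda>\<omega>. indicator B (X \<omega>) * r (X \<omega>))"
  shows "AE \<omega> in M. q (X \<omega>) \<le> r (X \<omega>)"
proof -
  define B where "B = {x. r x < q x}"
  have [measurable]: "B \<in> sets borel" unfolding B_def by measurable
  have i: "integrable M (\<lambda>\<omega>. indicator B (X \<omega>) * q (X \<omega>))"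
    "integrable M (\<lambda>\<omega>. indicator B (X \<omega>) * r (X \<omega>))"
    by (rule Bochner_Integration.integrable_bound[OF int(1)] Bochner_Integration.integrable_bound[OF int(2)];
        simp add: indicator_def)+
  have "expectation (\<lambda>\<omega>. indicator B (X \<omega>) * q (X \<omega>) - indicator B (X \<omega>) * r (X \<omega>)) = 0"
    using i eq[of B] by simp
  then have "AE \<omega> in M. indicator B (X \<omega>) * q (X \<omega>) - indicator B (X \<omega>) * r (X \<omega>) = 0"
    by (subst (asm) integral_nonneg_eq_0_iff_AE) (use i in \<open>auto simp: B_def indicator_def\<close>)
  then show ?thesis by eventually_elim (auto simp: B_def indicator_def split: if_splits)
qed

lemma (in prob_space) AE_eq_of_set_integrals:
  fixes q r :: "real \<Rightarrow> real"
  assumes "X \<in> borel_measurable M" "q \<in> borel_measurable borel" "r \<in> borel_measurable borel"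
    and "integrable M (\<lambda>\<omega>. q (X \<omega>))" "integrable M (\<lambda>\<omega>. r (X \<omega>))"
    and "\<And>B. B \<in> sets borel \<Longrightarrow>
      expectation (\<lambda>\<omega>. indicator B (X \<omega>) * q (X \<omega>)) = expectation (\<lambda>\<omega>. indicator B (X \<omega>) * r (X \<omega>))"
  shows "AE \<omega> in M. q (X \<omega>) = r (X \<omega>)"
proof -
  have "AE \<omega> in M. q (X \<omega>) \<le> r (X \<omega>)" "AE \<omega> in M. r (X \<omega>) \<le> q (X \<omega>)"
    using assms by (intro AE_le_of_set_integrals; simp)+
  then show ?thesis by eventually_elim simp
qed

text \<open>The defining property of the regression holds under the law given \<open>A = a\<close>.
  Written as integrals over \<open>M\<close>, both sides carry the same factor
  \<open>1 / prob E\<close>, which cancels.\<close>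

lemma (in prob_space) outcome_regression_set_integral:
  assumes A [measurable]: "A \<in> borel_measurable M" and P [measurable]: "P \<in> borel_measurable M"
    and Y: "integrable M Y" and pos: "prob {\<omega>\<in>space M. A \<omega> = a} \<noteq> 0"
    and \<nu>: "is_outcome_regression M A a P Y \<nu>" and B [measurable]: "B \<in> sets borel"
    and int: "integrable M (\<lambda>\<omega>. \<nu> (P \<omega>))"
  shows "expectation (\<lambda>\<omega>. indicator {\<omega>\<in>space M. A \<omega> = a} \<omega> * (indicator B (P \<omega>) * \<nu> (P \<omega>)))
    = expectation (\<lambda>\<omega>. indicator {\<omega>\<in>space M. A \<omega> = a} \<omega> * (indicator B (P \<omega>) * Y \<omega>))"
proof -
  define E where "E = {\<omega>\<in>space M. A \<omega> = a}"
  have [measurable]: "E \<in> sets M" unfolding E_def by measurable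
  define G where "G = given M A a"
  have G: "G = uniform_measure M E" by (simp add: G_def given_def E_def)
  have spG: "space G = space M" and seG [measurable_cong]: "sets G = sets M" by (simp_all add: G)
  interpret G: prob_space G
    unfolding G using pos by (intro prob_space_uniform_measure) (auto simp: E_def emeasure_eq_measure)
  have [measurable]: "Y \<in> borel_measurable M" using Y by simp
  have [measurable]: "\<nu> \<in> borel_measurable borel" using \<nu> by (simp add: is_outcome_regression_def)
  define F where "F = gen_alg M P borel"
  \<comment> \<open>A generated sigma-algebra sees only the underlying space, which conditioning
    leaves unchanged.\<close>
  have F': "F = gen_alg G P borel" by (simp add: F_def gen_alg_def spG)
  have sub: "subalgebra G F" unfolding F' by (rule subalgebra_gen_alg) measurable
  have [measurable]: "P \<in> borel_measurable F" unfolding F' by (rule measurable_gen_alg) measurable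
  interpret sigma_finite_subalgebra G F using sub by (rule G.sigma_finite_subalgebraI)
  have YB: "integrable M (\<lambda>\<omega>. indicator B (P \<omega>) * Y \<omega>)"
    and \<nu>B: "integrable M (\<lambda>\<omega>. indicator B (P \<omega>) * \<nu> (P \<omega>))"
    by (rule Bochner_Integration.integrable_bound[OF Y] Bochner_Integration.integrable_bound[OF int];
        simp add: indicator_def)+
  have YBG: "integrable G (\<lambda>\<omega>. indicator B (P \<omega>) * Y \<omega>)"
    unfolding G by (rule integrable_uniform_measure(1)[OF _ YB]) (use pos in \<open>simp_all add: E_def\<close>)
  have "AE \<omega> in G. indicator B (P \<omega>) * \<nu> (P \<omega>) = indicator B (P \<omega>) * real_cond_exp G F Y \<omega>"
    using \<nu> unfolding is_outcome_regression_def G_def F_def by (auto elim: eventually_mono)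
  then have "integral\<^sup>L G (\<lambda>\<omega>. indicator B (P \<omega>) * \<nu> (P \<omega>)) = integral\<^sup>L G (\<lambda>\<omega>. indicator B (P \<omega>) * real_cond_exp G F Y \<omega>)"
    by (intro integral_cong_AE) measurable
  also have "\<dots> = integral\<^sup>L G (\<lambda>\<omega>. indicator B (P \<omega>) * Y \<omega>)"
    by (rule real_cond_exp_intg(2)[OF YBG]) measurable
  finally show ?thesis
    unfolding G using integrable_uniform_measure(2)[OF _ YB, of E] integrable_uniform_measure(2)[OF _ \<nu>B, of E] pos
    by (simp add: E_def)
qed

lemma (in prob_space) integrable_mult_AE_bounded:
  fixes f h :: "'a \<Rightarrow> real"
  assumes h: "integrable M h" and [measurable]: "f \<in> borel_measurable M"
    and f: "AE \<omega> in M. \<bar>f \<omega>\<bar> \<le> C"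
  shows "integrable M (\<lambda>\<omega>. f \<omega> * h \<omega>)"
proof (rule Bochner_Integration.integrable_bound)
  show "integrable M (\<lambda>\<omega>. C * h \<omega>)" using h by simp
  show "AE \<omega> in M. norm (f \<omega> * h \<omega>) \<le> norm (C * h \<omega>)"
    using f by eventually_elim (auto simp: abs_mult intro!: mult_right_mono)
qed (use h in measurable)

subsection \<open>Selection with a multiplicative propensity\<close>

lemma borel_measurable_fst_snd [measurable]:
  "fst \<in> borel_measurable (borel :: ('a::topological_space \<times> 'b::topological_space) measure)"
  "snd \<in> borel_measurable (borel :: ('a::topological_space \<times> 'b::topological_space) measure)"
  by (intro borel_measurable_continuous_onI continuous_intros)+

text \<open>The last assumption is \<open>E(A | P) = P\<close>, stated through test functions.\<close>

locale selection_model = prob_space M for M :: "'a measure" +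
  fixes A P Y1 Y0 :: "'a \<Rightarrow> real" and g :: "real \<times> real \<Rightarrow> real"
  assumes A_meas [measurable]: "A \<in> borel_measurable M"
    and A01: "\<And>\<omega>. \<omega> \<in> space M \<Longrightarrow> A \<omega> \<in> {0, 1}"
    and P_meas [measurable]: "P \<in> borel_measurable M"
    and P01: "AE \<omega> in M. 0 < P \<omega> \<and> P \<omega> < 1"
    and Y1_int: "integrable M Y1" and Y0_int: "integrable M Y0"
    and g_meas [measurable]: "g \<in> borel_measurable borel"
    and g_nonneg: "AE \<omega> in M. 0 \<le> g (Y1 \<omega>, Y0 \<omega>)"
    and indep: "\<And>\<phi> :: real \<times> real \<Rightarrow> real. \<phi> \<in> borel_measurable borel \<Longrightarrow>
        indep_var borel P borel (\<lambda>\<omega>. \<phi> (Y1 \<omega>, Y0 \<omega>))"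
    and selection: "AE \<omega> in M. pr_given M (gen_alg M (\<lambda>\<omega>. (P \<omega>, Y1 \<omega>, Y0 \<omega>)) borel)
        {\<omega>\<in>space M. A \<omega> = 1} \<omega> = P \<omega> * g (Y1 \<omega>, Y0 \<omega>)"
    and propensity: "\<And>f :: real \<Rightarrow> real. f \<in> borel_measurable borel \<Longrightarrow> integrable M (\<lambda>\<omega>. f (P \<omega>)) \<Longrightarrow>
        expectation (\<lambda>\<omega>. f (P \<omega>) * A \<omega>) = expectation (\<lambda>\<omega>. f (P \<omega>) * P \<omega>)"
begin

lemma Y_meas [measurable]: "Y1 \<in> borel_measurable M" "Y0 \<in> borel_measurable M"
  using Y1_int Y0_int by simp_all

abbreviation U :: "'a \<Rightarrow> real \<times> real" where "U \<omega> \<equiv> (Y1 \<omega>, Y0 \<omega>)"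

definition "\<mu> = expectation P"

lemma P_bound: "AE \<omega> in M. \<bar>P \<omega>\<bar> \<le> 1"
  using P01 by eventually_elim auto

lemma P_int: "integrable M P"
  using P_bound by (intro integrable_const_bound) auto

lemma A_bound: "AE \<omega> in M. \<bar>A \<omega>\<bar> \<le> 1"
proof (rule AE_I2)
  show "\<bar>A \<omega>\<bar> \<le> 1" if "\<omega> \<in> space M" for \<omega> using A01[OF that] by auto
qed

lemma \<mu>_bounds: "0 < \<mu>" "\<mu> < 1"
proof -
  show "0 < \<mu>" unfolding \<mu>_def
    using P01 by (intro expectation_greater[OF P_int]) (auto elim: eventually_mono)
  show "\<mu> < 1" unfolding \<mu>_def
    using P01 by (intro expectation_less[OF P_int]) (auto elim: eventually_mono)
qed

lemma indicator_A:
  assumes "\<omega> \<in> space M"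
  shows "indicator {\<omega>\<in>space M. A \<omega> = 1} \<omega> = A \<omega>" "indicator {\<omega>\<in>space M. A \<omega> = 0} \<omega> = 1 - A \<omega>"
proof -
  show "indicator {\<omega>\<in>space M. A \<omega> = 1} \<omega> = A \<omega>"
    using A01[OF assms] assms by (auto simp: indicator_def)
  show "indicator {\<omega>\<in>space M. A \<omega> = 0} \<omega> = 1 - A \<omega>"
    using A01[OF assms] assms by (auto simp: indicator_def)
qed

lemma indep_mult:
  fixes f :: "real \<Rightarrow> real" and \<phi> :: "real \<times> real \<Rightarrow> real"
  assumes [measurable]: "f \<in> borel_measurable borel" "\<phi> \<in> borel_measurable borel"
    and int: "integrable M (\<lambda>\<omega>. f (P \<omega>))" "integrable M (\<lambda>\<omega>. \<phi> (U \<omega>))"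
  shows "integrable M (\<lambda>\<omega>. f (P \<omega>) * \<phi> (U \<omega>))"
    and "expectation (\<lambda>\<omega>. f (P \<omega>) * \<phi> (U \<omega>)) = expectation (\<lambda>\<omega>. f (P \<omega>)) * expectation (\<lambda>\<omega>. \<phi> (U \<omega>))"
proof -
  have i: "indep_var borel (\<lambda>\<omega>. f (P \<omega>)) borel (\<lambda>\<omega>. \<phi> (U \<omega>))"
    using indep_var_compose[OF indep[of \<phi>], of f borel id borel] by (simp add: comp_def)
  show "integrable M (\<lambda>\<omega>. f (P \<omega>) * \<phi> (U \<omega>))"
    using i int by (rule indep_var_integrable)
  show "expectation (\<lambda>\<omega>. f (P \<omega>) * \<phi> (U \<omega>)) = expectation (\<lambda>\<omega>. f (P \<omega>)) * expectation (\<lambda>\<omega>. \<phi> (U \<omega>))"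
    using i int by (rule indep_var_lebesgue_integral)
qed

lemma expectation_selection:
  fixes h :: "real \<times> real \<times> real \<Rightarrow> real"
  assumes [measurable]: "h \<in> borel_measurable borel"
    and int: "integrable M (\<lambda>\<omega>. h (P \<omega>, U \<omega>))"
  shows "expectation (\<lambda>\<omega>. h (P \<omega>, U \<omega>) * A \<omega>)
    = expectation (\<lambda>\<omega>. h (P \<omega>, U \<omega>) * (P \<omega> * g (U \<omega>)))"
proof -
  define X where "X = (\<lambda>\<omega>. (P \<omega>, U \<omega>))"
  have [measurable]: "X \<in> borel_measurable M" unfolding X_def by measurable
  have [measurable]: "X \<in> borel_measurable (gen_alg M X borel)" by (rule measurable_gen_alg) measurable
  have sub: "subalgebra M (gen_alg M X borel)" by (rule subalgebra_gen_alg) measurable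
  have "integrable M (\<lambda>\<omega>. A \<omega> * h (X \<omega>))"
    using int A_bound unfolding X_def by (intro integrable_mult_AE_bounded) auto
  then have i: "integrable M (\<lambda>\<omega>. h (X \<omega>) * indicator {\<omega>\<in>space M. A \<omega> = 1} \<omega>)"
    by (simp add: indicator_A mult.commute cong: Bochner_Integration.integrable_cong)
  have "(\<lambda>\<omega>. h (X \<omega>)) \<in> borel_measurable (gen_alg M X borel)" by measurable
  from expectation_mult_pr_given(2)[OF sub this _ _ selection[folded X_def] i]
  show ?thesis
    by (simp add: X_def indicator_A cong: Bochner_Integration.integral_cong)
qed

text \<open>As a conditional probability, \<open>P * g\<close> is at most 1 almost surely. For a
  suitable \<open>p > 0\<close> the event \<open>P > p\<close> has positive probability and is
  almost surely disjoint from \<open>g > 1 / p\<close>. The two events are also independent, so the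
  second one is null.\<close>

lemma g_bounded:
  obtains C where "AE \<omega> in M. g (U \<omega>) \<le> C"
proof -
  define X where "X = (\<lambda>\<omega>. (P \<omega>, U \<omega>))"
  have [measurable]: "X \<in> borel_measurable M" unfolding X_def by measurable
  interpret S: sigma_finite_subalgebra M "gen_alg M X borel"
    by (intro sigma_finite_subalgebraI subalgebra_gen_alg) measurable
  have "AE \<omega> in M. pr_given M (gen_alg M X borel) {\<omega>\<in>space M. A \<omega> = 1} \<omega> \<le> 1"
    unfolding pr_given_def
    by (rule S.real_cond_exp_le_c) (auto simp: indicator_def emeasure_eq_measure intro!: integrable_real_indicator)
  with selection[folded X_def] have le1: "AE \<omega> in M. P \<omega> * g (U \<omega>) \<le> 1"
    by eventually_elim simp
  \<comment> \<open>Since \<open>P\<close> is almost surely positive, some threshold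
    \<open>1 / Suc n\<close> is exceeded with positive probability.\<close>
  have "\<exists>n::nat. \<not> (AE \<omega> in M. P \<omega> \<le> 1 / Suc n)"
  proof (rule ccontr)
    assume "\<not> ?thesis"
    then have "AE \<omega> in M. \<forall>n::nat. P \<omega> \<le> 1 / Suc n" by (simp add: AE_all_countable)
    with P01 have "AE \<omega> in M. False"
    proof eventually_elim
      case (elim \<omega>)
      then obtain n where "inverse (real (Suc n)) < P \<omega>" using reals_Archimedean by blast
      with elim(2) show ?case by (metis inverse_eq_divide not_le)
    qed
    then show False by simp
  qed
  then obtain n :: nat where n: "\<not> (AE \<omega> in M. P \<omega> \<le> 1 / Suc n)" by blast
  define p :: real where "p = 1 / Suc n"
  have p: "0 < p" by (simp add: p_def)
  define f where "f = (indicator {p<..} :: real \<Rightarrow> real)"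
  define \<phi> where "\<phi> = (indicator {u. 1 / p < g u} :: real \<times> real \<Rightarrow> real)"
  have [measurable]: "f \<in> borel_measurable borel" "\<phi> \<in> borel_measurable borel"
    unfolding f_def \<phi>_def by measurable
  have int: "integrable M (\<lambda>\<omega>. f (P \<omega>))" "integrable M (\<lambda>\<omega>. \<phi> (U \<omega>))"
    by (intro integrable_const_bound[of _ 1]; simp add: f_def \<phi>_def indicator_def)+
  have "AE \<omega> in M. f (P \<omega>) * \<phi> (U \<omega>) = 0"
    using le1
  proof eventually_elim
    case (elim \<omega>)
    have False if "p < P \<omega>" "1 / p < g (U \<omega>)"
    proof -
      have "p * (1 / p) < P \<omega> * g (U \<omega>)" using that p by (intro mult_strict_mono) auto
      with elim p show False by simp
    qed
    then show ?case by (auto simp: f_def \<phi>_def indicator_def)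
  qed
  then have "expectation (\<lambda>\<omega>. f (P \<omega>) * \<phi> (U \<omega>)) = 0" by (rule integral_eq_zero_AE)
  moreover have "expectation (\<lambda>\<omega>. f (P \<omega>)) \<noteq> 0"
  proof
    assume "expectation (\<lambda>\<omega>. f (P \<omega>)) = 0"
    then have "AE \<omega> in M. f (P \<omega>) = 0"
      by (subst (asm) integral_nonneg_eq_0_iff_AE) (use int in \<open>auto simp: f_def\<close>)
    then have "AE \<omega> in M. P \<omega> \<le> 1 / Suc n"
      by eventually_elim (auto simp: f_def p_def indicator_def not_less split: if_splits)
    with n show False by simp
  qed
  ultimately have "expectation (\<lambda>\<omega>. \<phi> (U \<omega>)) = 0"
    using indep_mult(2)[of f \<phi>] int by simp
  then have "AE \<omega> in M. \<phi> (U \<omega>) = 0"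
    by (subst (asm) integral_nonneg_eq_0_iff_AE) (use int in \<open>auto simp: \<phi>_def\<close>)
  then have "AE \<omega> in M. g (U \<omega>) \<le> 1 / p"
    by eventually_elim (auto simp: \<phi>_def indicator_def not_less split: if_splits)
  with that show ?thesis .
qed

lemma integrable_g_mult:
  assumes "integrable M \<psi>"
  shows "integrable M (\<lambda>\<omega>. g (U \<omega>) * \<psi> \<omega>)"
proof -
  obtain C where "AE \<omega> in M. g (U \<omega>) \<le> C" by (rule g_bounded)
  with g_nonneg have "AE \<omega> in M. \<bar>g (U \<omega>)\<bar> \<le> C" by eventually_elim simp
  with assms show ?thesis by (intro integrable_mult_AE_bounded) auto
qed

text \<open>Selection replaces \<open>A\<close> by \<open>P * g\<close>; independence of
  \<open>P\<close> and \<open>U\<close> then separates the factors.\<close>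

lemma expectation_A_mult:
  fixes f :: "real \<Rightarrow> real" and \<phi> :: "real \<times> real \<Rightarrow> real"
  assumes [measurable]: "f \<in> borel_measurable borel" "\<phi> \<in> borel_measurable borel"
    and int: "integrable M (\<lambda>\<omega>. f (P \<omega>))" "integrable M (\<lambda>\<omega>. \<phi> (U \<omega>))"
  shows "expectation (\<lambda>\<omega>. A \<omega> * (f (P \<omega>) * \<phi> (U \<omega>)))
    = expectation (\<lambda>\<omega>. P \<omega> * f (P \<omega>)) * expectation (\<lambda>\<omega>. g (U \<omega>) * \<phi> (U \<omega>))"
proof -
  have Pf: "integrable M (\<lambda>\<omega>. P \<omega> * f (P \<omega>))"
    using int(1) P_bound by (intro integrable_mult_AE_bounded) auto
  have "expectation (\<lambda>\<omega>. (f (P \<omega>) * \<phi> (U \<omega>)) * A \<omega>)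
      = expectation (\<lambda>\<omega>. (f (P \<omega>) * \<phi> (U \<omega>)) * (P \<omega> * g (U \<omega>)))"
    using expectation_selection[of "\<lambda>x. f (fst x) * \<phi> (snd x)"] indep_mult(1)[OF assms(1,2) int] by simp
  also have "\<dots> = expectation (\<lambda>\<omega>. (P \<omega> * f (P \<omega>)) * (g (U \<omega>) * \<phi> (U \<omega>)))"
    by (simp add: ac_simps)
  also have "\<dots> = expectation (\<lambda>\<omega>. P \<omega> * f (P \<omega>)) * expectation (\<lambda>\<omega>. g (U \<omega>) * \<phi> (U \<omega>))"
    by (rule indep_mult(2)[of "\<lambda>p. p * f p" "\<lambda>u. g u * \<phi> u"]) (use Pf integrable_g_mult[OF int(2)] in auto)
  finally show ?thesis by (simp add: mult.commute)
qed

lemma expectation_A: "expectation A = \<mu>"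
proof -
  have "expectation (\<lambda>\<omega>. 1 * A \<omega>) = expectation (\<lambda>\<omega>. 1 * P \<omega>)"
    by (rule propensity) simp_all
  then show ?thesis by (simp add: \<mu>_def)
qed

lemma expectation_g: "expectation (\<lambda>\<omega>. g (U \<omega>)) = 1"
proof -
  have "expectation (\<lambda>\<omega>. A \<omega> * (1 * 1)) = expectation (\<lambda>\<omega>. P \<omega> * 1) * expectation (\<lambda>\<omega>. g (U \<omega>) * 1)"
    by (rule expectation_A_mult) simp_all
  then have "\<mu> = \<mu> * expectation (\<lambda>\<omega>. g (U \<omega>))"
    using expectation_A by (simp add: \<mu>_def)
  then show ?thesis using \<mu>_bounds by simp
qed

lemma prob_A: "prob {\<omega>\<in>space M. A \<omega> = 1} = \<mu>" "prob {\<omega>\<in>space M. A \<omega> = 0} = 1 - \<mu>"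
proof -
  have "expectation (indicator {\<omega>\<in>space M. A \<omega> = 1}) = expectation A"
    by (rule Bochner_Integration.integral_cong[OF refl]) (rule indicator_A)
  then show "prob {\<omega>\<in>space M. A \<omega> = 1} = \<mu>" by (simp add: expectation_A)
  have A_int: "integrable M A" using A_bound by (intro integrable_const_bound) auto
  have "expectation (indicator {\<omega>\<in>space M. A \<omega> = 0}) = expectation (\<lambda>\<omega>. 1 - A \<omega>)"
    by (rule Bochner_Integration.integral_cong[OF refl]) (rule indicator_A)
  then show "prob {\<omega>\<in>space M. A \<omega> = 0} = 1 - \<mu>" using A_int by (simp add: expectation_A prob_space)
qed

lemma integral_given:
  assumes "integrable M X"
  shows "integral\<^sup>L (given M A 1) X = expectation (\<lambda>\<omega>. A \<omega> * X \<omega>) / \<mu>"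
    and "integral\<^sup>L (given M A 0) X = (expectation X - expectation (\<lambda>\<omega>. A \<omega> * X \<omega>)) / (1 - \<mu>)"
proof -
  have AX: "integrable M (\<lambda>\<omega>. A \<omega> * X \<omega>)"
    using assms A_bound by (intro integrable_mult_AE_bounded) auto
  have "expectation (\<lambda>\<omega>. indicator {\<omega>\<in>space M. A \<omega> = 1} \<omega> * X \<omega>) = expectation (\<lambda>\<omega>. A \<omega> * X \<omega>)"
    by (rule Bochner_Integration.integral_cong[OF refl]) (simp only: indicator_A)
  then show "integral\<^sup>L (given M A 1) X = expectation (\<lambda>\<omega>. A \<omega> * X \<omega>) / \<mu>"
    using integrable_uniform_measure(2)[OF _ assms, of "{\<omega>\<in>space M. A \<omega> = 1}"] \<mu>_bounds
    by (simp add: given_def prob_A)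
  have "expectation (\<lambda>\<omega>. indicator {\<omega>\<in>space M. A \<omega> = 0} \<omega> * X \<omega>) = expectation (\<lambda>\<omega>. (1 - A \<omega>) * X \<omega>)"
    by (rule Bochner_Integration.integral_cong[OF refl]) (simp only: indicator_A)
  then have "integral\<^sup>L (given M A 0) X = expectation (\<lambda>\<omega>. (1 - A \<omega>) * X \<omega>) / (1 - \<mu>)"
    using integrable_uniform_measure(2)[OF _ assms, of "{\<omega>\<in>space M. A \<omega> = 0}"] \<mu>_bounds
    by (simp add: given_def prob_A)
  also have "expectation (\<lambda>\<omega>. (1 - A \<omega>) * X \<omega>) = expectation X - expectation (\<lambda>\<omega>. A \<omega> * X \<omega>)"
    using assms AX by (simp add: left_diff_distrib)
  finally show "integral\<^sup>L (given M A 0) X = (expectation X - expectation (\<lambda>\<omega>. A \<omega> * X \<omega>)) / (1 - \<mu>)" .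
qed

end

text \<open>Convexity of the reciprocal: the left side is its tangent at \<open>a\<close>, evaluated
  at \<open>b\<close>.\<close>

lemma inverse_tangent_le:
  fixes a b :: real
  assumes "0 < a" "0 < b"
  shows "1 / a + (a - b) / a\<^sup>2 \<le> 1 / b"
proof -
  have "0 \<le> (a - b)\<^sup>2" by simp
  then have "(2 * a - b) * b \<le> a\<^sup>2" by (simp add: power2_eq_square algebra_simps)
  then have "(2 * a - b) / a\<^sup>2 \<le> 1 / b" using assms by (simp add: divide_simps)
  moreover have "1 / a + (a - b) / a\<^sup>2 = (2 * a - b) / a\<^sup>2"
    using assms by (simp add: divide_simps power2_eq_square)
  ultimately show ?thesis by simp
qed

section \<open>Means of the potential outcomes under selection\<close>

context selection_model
begin

definition "e1 = expectation Y1"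
definition "e0 = expectation Y0"
text \<open>Since \<open>g (U)\<close> has mean 1, it is a density; by
  \<open>expectation_A_mult\<close> with \<open>f = 1\<close> it turns the law of \<open>U\<close>
  into its law given \<open>A = 1\<close>. Thus \<open>m1\<close> and \<open>m0\<close> are the
  means of the potential outcomes among the treated.\<close>

definition "m1 = expectation (\<lambda>\<omega>. g (U \<omega>) * Y1 \<omega>)"
definition "m0 = expectation (\<lambda>\<omega>. g (U \<omega>) * Y0 \<omega>)"

lemma expectation_A_P_Y:
  fixes f :: "real \<Rightarrow> real"
  assumes f: "f \<in> borel_measurable borel" "integrable M (\<lambda>\<omega>. f (P \<omega>))"
  shows "expectation (\<lambda>\<omega>. A \<omega> * (f (P \<omega>) * Y1 \<omega>)) = expectation (\<lambda>\<omega>. P \<omega> * f (P \<omega>)) * m1"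
    and "expectation (\<lambda>\<omega>. A \<omega> * (f (P \<omega>) * Y0 \<omega>)) = expectation (\<lambda>\<omega>. P \<omega> * f (P \<omega>)) * m0"
proof -
  have int: "integrable M (\<lambda>\<omega>. fst (U \<omega>))" "integrable M (\<lambda>\<omega>. snd (U \<omega>))"
    using Y1_int Y0_int by simp_all
  show "expectation (\<lambda>\<omega>. A \<omega> * (f (P \<omega>) * Y1 \<omega>)) = expectation (\<lambda>\<omega>. P \<omega> * f (P \<omega>)) * m1"
    using expectation_A_mult[OF f(1) borel_measurable_fst_snd(1) f(2) int(1)] by (simp add: m1_def)
  show "expectation (\<lambda>\<omega>. A \<omega> * (f (P \<omega>) * Y0 \<omega>)) = expectation (\<lambda>\<omega>. P \<omega> * f (P \<omega>)) * m0"
    using expectation_A_mult[OF f(1) borel_measurable_fst_snd(2) f(2) int(2)] by (simp add: m0_def)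
qed

lemma expectation_A_Y:
  "expectation (\<lambda>\<omega>. A \<omega> * Y1 \<omega>) = \<mu> * m1" "expectation (\<lambda>\<omega>. A \<omega> * Y0 \<omega>) = \<mu> * m0"
proof -
  have one: "(\<lambda>_. 1) \<in> borel_measurable borel" "integrable M (\<lambda>_. 1 :: real)" by simp_all
  show "expectation (\<lambda>\<omega>. A \<omega> * Y1 \<omega>) = \<mu> * m1" "expectation (\<lambda>\<omega>. A \<omega> * Y0 \<omega>) = \<mu> * m0"
    using expectation_A_P_Y[OF one] by (simp_all add: \<mu>_def)
qed

lemma given_Y1: "integral\<^sup>L (given M A 1) Y1 = m1" "integral\<^sup>L (given M A 0) Y1 = (e1 - \<mu> * m1) / (1 - \<mu>)"
  using integral_given[OF Y1_int] \<mu>_bounds by (simp_all add: expectation_A_Y e1_def)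

lemma given_Y0: "integral\<^sup>L (given M A 1) Y0 = m0" "integral\<^sup>L (given M A 0) Y0 = (e0 - \<mu> * m0) / (1 - \<mu>)"
  using integral_given[OF Y0_int] \<mu>_bounds by (simp_all add: expectation_A_Y e0_def)

lemma A_mult_int:
  assumes "integrable M X"
  shows "integrable M (\<lambda>\<omega>. A \<omega> * X \<omega>)"
  using assms A_meas A_bound by (rule integrable_mult_AE_bounded)

lemma P_mult_int:
  assumes "integrable M X"
  shows "integrable M (\<lambda>\<omega>. P \<omega> * X \<omega>)"
  using assms P_meas P_bound by (rule integrable_mult_AE_bounded)

end

section \<open>Observed outcome, regressions and the six comparisons\<close>

locale observed_selection_model = selection_model +
  fixes Y :: "'a \<Rightarrow> real"
  assumes Y: "\<And>\<omega>. \<omega> \<in> space M \<Longrightarrow> Y \<omega> = A \<omega> * Y1 \<omega> + (1 - A \<omega>) * Y0 \<omega>"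
begin

lemma Y_int: "integrable M Y"
proof -
  have "integrable M (\<lambda>\<omega>. A \<omega> * Y1 \<omega> + (Y0 \<omega> - A \<omega> * Y0 \<omega>))"
    using A_mult_int Y1_int Y0_int by simp
  moreover have "integrable M Y \<longleftrightarrow> integrable M (\<lambda>\<omega>. A \<omega> * Y1 \<omega> + (Y0 \<omega> - A \<omega> * Y0 \<omega>))"
    by (rule Bochner_Integration.integrable_cong[OF refl]) (simp only: Y left_diff_distrib mult_1)
  ultimately show ?thesis by simp
qed

lemma A_mult_Y:
  assumes "\<omega> \<in> space M"
  shows "A \<omega> * Y \<omega> = A \<omega> * Y1 \<omega>" "(1 - A \<omega>) * Y \<omega> = (1 - A \<omega>) * Y0 \<omega>"
  using A01[OF assms] Y[OF assms] by auto

lemma given_Y: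
  "integral\<^sup>L (given M A 1) Y = m1" "integral\<^sup>L (given M A 0) Y = (e0 - \<mu> * m0) / (1 - \<mu>)"
proof -
  have AY: "expectation (\<lambda>\<omega>. A \<omega> * Y \<omega>) = \<mu> * m1"
    unfolding expectation_A_Y[symmetric]
    by (rule Bochner_Integration.integral_cong[OF refl]) (rule A_mult_Y)
  then show "integral\<^sup>L (given M A 1) Y = m1"
    using integral_given(1)[OF Y_int] \<mu>_bounds by simp
  have "expectation Y - expectation (\<lambda>\<omega>. A \<omega> * Y \<omega>) = expectation (\<lambda>\<omega>. (1 - A \<omega>) * Y \<omega>)"
    using Y_int A_mult_int[OF Y_int] by (simp add: left_diff_distrib)
  also have "\<dots> = expectation (\<lambda>\<omega>. (1 - A \<omega>) * Y0 \<omega>)"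
    by (rule Bochner_Integration.integral_cong[OF refl]) (rule A_mult_Y)
  also have "\<dots> = e0 - \<mu> * m0"
    using Y0_int A_mult_int[OF Y0_int] by (simp add: left_diff_distrib expectation_A_Y e0_def)
  finally show "integral\<^sup>L (given M A 0) Y = (e0 - \<mu> * m0) / (1 - \<mu>)"
    using integral_given(2)[OF Y_int] by simp
qed

text \<open>On \<open>A = 1\<close> the outcome is \<open>Y1\<close>. Integrating over
  \<open>P \<in> B\<close>, with \<open>A\<close> replaced by \<open>P\<close> or by
  \<open>P * g\<close>, identifies \<open>P * \<nu> (P)\<close> with \<open>P * m1\<close>;
  positivity of \<open>P\<close> cancels the factor.\<close>

lemma regression_1:
  assumes \<nu>: "is_outcome_regression M A 1 P Y \<nu>" and int: "integrable M (\<lambda>\<omega>. \<nu> (P \<omega>))"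
  shows "AE \<omega> in M. \<nu> (P \<omega>) = m1"
proof -
  have [measurable]: "\<nu> \<in> borel_measurable borel" using \<nu> by (simp add: is_outcome_regression_def)
  have "AE \<omega> in M. P \<omega> * \<nu> (P \<omega>) = P \<omega> * m1"
  proof (rule AE_eq_of_set_integrals[where q = "\<lambda>p. p * \<nu> p" and r = "\<lambda>p. p * m1"])
    fix B :: "real set" assume [measurable]: "B \<in> sets borel"
    have B: "integrable M (\<lambda>\<omega>. indicator B (P \<omega>) :: real)"
      by (rule integrable_const_bound[of _ 1]) (simp_all add: indicator_def)
    have B\<nu>: "integrable M (\<lambda>\<omega>. indicator B (P \<omega>) * \<nu> (P \<omega>))"
      by (rule integrable_mult_AE_bounded[OF int, of _ 1]) (simp_all add: indicator_def)
    have "expectation (\<lambda>\<omega>. indicator B (P \<omega>) * (P \<omega> * \<nu> (P \<omega>)))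
        = expectation (\<lambda>\<omega>. (indicator B (P \<omega>) * \<nu> (P \<omega>)) * P \<omega>)"
      by (simp only: ac_simps)
    also have "\<dots> = expectation (\<lambda>\<omega>. (indicator B (P \<omega>) * \<nu> (P \<omega>)) * A \<omega>)"
      by (rule propensity[symmetric]) (use B\<nu> in measurable)
    also have "\<dots> = expectation (\<lambda>\<omega>. indicator {\<omega>\<in>space M. A \<omega> = 1} \<omega> * (indicator B (P \<omega>) * \<nu> (P \<omega>)))"
      by (rule Bochner_Integration.integral_cong[OF refl]) (simp only: indicator_A mult.commute)
    also have "\<dots> = expectation (\<lambda>\<omega>. indicator {\<omega>\<in>space M. A \<omega> = 1} \<omega> * (indicator B (P \<omega>) * Y \<omega>))"
      by (rule outcome_regression_set_integral[OF A_meas P_meas Y_int _ \<nu> _ int]) (use \<mu>_bounds in \<open>simp_all add: prob_A\<close>)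
    also have "\<dots> = expectation (\<lambda>\<omega>. A \<omega> * (indicator B (P \<omega>) * Y1 \<omega>))"
      by (rule Bochner_Integration.integral_cong[OF refl])
        (simp only: indicator_A mult.left_commute[of "A _"] A_mult_Y)
    also have "\<dots> = expectation (\<lambda>\<omega>. P \<omega> * indicator B (P \<omega>)) * m1"
      by (rule expectation_A_P_Y) (use B in measurable)
    also have "\<dots> = expectation (\<lambda>\<omega>. (P \<omega> * indicator B (P \<omega>)) * m1)" by simp
    also have "\<dots> = expectation (\<lambda>\<omega>. indicator B (P \<omega>) * (P \<omega> * m1))"
      by (simp only: ac_simps)
    finally show "expectation (\<lambda>\<omega>. indicator B (P \<omega>) * (P \<omega> * \<nu> (P \<omega>)))
        = expectation (\<lambda>\<omega>. indicator B (P \<omega>) * (P \<omega> * m1))" .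
  qed (use P_mult_int[OF int] P_int in \<open>simp_all\<close>)
  with P01 show ?thesis by eventually_elim simp
qed

text \<open>The same test-set argument with \<open>1 - A\<close> and \<open>Y0\<close>. The factor
  \<open>1 - P\<close> stays in place, so that both sides are integrable without any condition on
  \<open>1 / (1 - P)\<close>.\<close>

lemma regression_0:
  assumes \<nu>: "is_outcome_regression M A 0 P Y \<nu>" and int: "integrable M (\<lambda>\<omega>. \<nu> (P \<omega>))"
  shows "AE \<omega> in M. (1 - P \<omega>) * \<nu> (P \<omega>) = e0 - P \<omega> * m0"
proof (rule AE_eq_of_set_integrals[where q = "\<lambda>p. (1 - p) * \<nu> p" and r = "\<lambda>p. e0 - p * m0"])
  have [measurable]: "\<nu> \<in> borel_measurable borel" using \<nu> by (simp add: is_outcome_regression_def)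
  then show "(\<lambda>p. (1 - p) * \<nu> p) \<in> borel_measurable borel" by measurable
  fix B :: "real set" assume [measurable]: "B \<in> sets borel"
  have B: "integrable M (\<lambda>\<omega>. indicator B (P \<omega>) :: real)"
    by (rule integrable_const_bound[of _ 1]) (simp_all add: indicator_def)
  have B\<nu>: "integrable M (\<lambda>\<omega>. indicator B (P \<omega>) * \<nu> (P \<omega>))"
    by (rule integrable_mult_AE_bounded[OF int, of _ 1]) (simp_all add: indicator_def)
  have BY0: "integrable M (\<lambda>\<omega>. indicator B (P \<omega>) * Y0 \<omega>)"
    by (rule integrable_mult_AE_bounded[OF Y0_int, of _ 1]) (simp_all add: indicator_def)
  have "expectation (\<lambda>\<omega>. indicator B (P \<omega>) * ((1 - P \<omega>) * \<nu> (P \<omega>)))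
      = expectation (\<lambda>\<omega>. indicator B (P \<omega>) * \<nu> (P \<omega>) - (indicator B (P \<omega>) * \<nu> (P \<omega>)) * P \<omega>)"
    by (simp only: algebra_simps mult_1 mult_1_right)
  also have "\<dots> = expectation (\<lambda>\<omega>. indicator B (P \<omega>) * \<nu> (P \<omega>)) - expectation (\<lambda>\<omega>. (indicator B (P \<omega>) * \<nu> (P \<omega>)) * P \<omega>)"
    using B\<nu> P_mult_int[OF B\<nu>] by (intro Bochner_Integration.integral_diff) (simp_all only: mult.commute)
  also have "expectation (\<lambda>\<omega>. (indicator B (P \<omega>) * \<nu> (P \<omega>)) * P \<omega>)
      = expectation (\<lambda>\<omega>. (indicator B (P \<omega>) * \<nu> (P \<omega>)) * A \<omega>)"
    by (rule propensity[symmetric]) (use B\<nu> \<nu> in \<open>simp_all add: is_outcome_regression_def\<close>)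
  also have "expectation (\<lambda>\<omega>. indicator B (P \<omega>) * \<nu> (P \<omega>)) - \<dots>
      = expectation (\<lambda>\<omega>. indicator B (P \<omega>) * \<nu> (P \<omega>) - (indicator B (P \<omega>) * \<nu> (P \<omega>)) * A \<omega>)"
    using B\<nu> A_mult_int[OF B\<nu>] by (intro Bochner_Integration.integral_diff[symmetric]) (simp_all only: mult.commute)
  also have "\<dots> = expectation (\<lambda>\<omega>. indicator {\<omega>\<in>space M. A \<omega> = 0} \<omega> * (indicator B (P \<omega>) * \<nu> (P \<omega>)))"
    by (rule Bochner_Integration.integral_cong[OF refl]) (simp only: indicator_A algebra_simps mult_1 mult_1_right)
  also have "\<dots> = expectation (\<lambda>\<omega>. indicator {\<omega>\<in>space M. A \<omega> = 0} \<omega> * (indicator B (P \<omega>) * Y \<omega>))"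
    by (rule outcome_regression_set_integral[OF A_meas P_meas Y_int _ \<nu> _ int]) (use \<mu>_bounds in \<open>simp_all add: prob_A\<close>)
  also have "\<dots> = expectation (\<lambda>\<omega>. indicator B (P \<omega>) * ((1 - A \<omega>) * Y0 \<omega>))"
    by (rule Bochner_Integration.integral_cong[OF refl])
      (simp only: indicator_A mult.left_commute[of "1 - A _"] A_mult_Y)
  also have "\<dots> = expectation (\<lambda>\<omega>. indicator B (P \<omega>) * Y0 \<omega> - A \<omega> * (indicator B (P \<omega>) * Y0 \<omega>))"
    by (simp only: algebra_simps mult_1 mult_1_right)
  also have "\<dots> = expectation (\<lambda>\<omega>. indicator B (P \<omega>) * Y0 \<omega>) - expectation (\<lambda>\<omega>. A \<omega> * (indicator B (P \<omega>) * Y0 \<omega>))"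
    using BY0 A_mult_int[OF BY0] by (rule Bochner_Integration.integral_diff)
  also have "expectation (\<lambda>\<omega>. A \<omega> * (indicator B (P \<omega>) * Y0 \<omega>)) = expectation (\<lambda>\<omega>. P \<omega> * indicator B (P \<omega>)) * m0"
    by (rule expectation_A_P_Y) (use B in measurable)
  also have "expectation (\<lambda>\<omega>. indicator B (P \<omega>) * Y0 \<omega>) = expectation (\<lambda>\<omega>. indicator B (P \<omega>)) * e0"
    using indep_mult(2)[OF _ borel_measurable_fst_snd(2) B] Y0_int by (simp add: e0_def)
  also have "expectation (\<lambda>\<omega>. indicator B (P \<omega>)) * e0 - expectation (\<lambda>\<omega>. P \<omega> * indicator B (P \<omega>)) * m0
      = expectation (\<lambda>\<omega>. indicator B (P \<omega>) * e0 - (P \<omega> * indicator B (P \<omega>)) * m0)"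
    using B P_mult_int[OF B] by simp
  also have "\<dots> = expectation (\<lambda>\<omega>. indicator B (P \<omega>) * (e0 - P \<omega> * m0))"
    by (simp only: algebra_simps mult_1 mult_1_right)
  finally show "expectation (\<lambda>\<omega>. indicator B (P \<omega>) * ((1 - P \<omega>) * \<nu> (P \<omega>)))
      = expectation (\<lambda>\<omega>. indicator B (P \<omega>) * (e0 - P \<omega> * m0))" .
qed (use \<nu> P_mult_int[OF int] int P_int in \<open>simp_all add: is_outcome_regression_def left_diff_distrib\<close>)

text \<open>Functions of \<open>P\<close> alone do not distinguish \<open>A\<close> from
  \<open>P\<close> as a weight, by \<open>propensity\<close>; so averages over either treatment
  group become averages over \<open>M\<close>.\<close>

lemma integral_distr_P:
  assumes [measurable]: "\<nu> \<in> borel_measurable borel" and int: "integrable M (\<lambda>\<omega>. \<nu> (P \<omega>))"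
  shows "integral\<^sup>L (distr M borel P) \<nu> = expectation (\<lambda>\<omega>. \<nu> (P \<omega>))"
    and "integral\<^sup>L (distr (given M A 1) borel P) \<nu> = expectation (\<lambda>\<omega>. P \<omega> * \<nu> (P \<omega>)) / \<mu>"
    and "integral\<^sup>L (distr (given M A 0) borel P) \<nu> =
      (expectation (\<lambda>\<omega>. \<nu> (P \<omega>)) - expectation (\<lambda>\<omega>. P \<omega> * \<nu> (P \<omega>))) / (1 - \<mu>)"
proof -
  have m: "P \<in> borel_measurable (given M A a)" for a by (simp add: given_def)
  show "integral\<^sup>L (distr M borel P) \<nu> = expectation (\<lambda>\<omega>. \<nu> (P \<omega>))"
    by (rule integral_distr) measurable
  have *: "expectation (\<lambda>\<omega>. A \<omega> * \<nu> (P \<omega>)) = expectation (\<lambda>\<omega>. P \<omega> * \<nu> (P \<omega>))"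
    using propensity[OF assms] by (simp only: mult.commute)
  show "integral\<^sup>L (distr (given M A 1) borel P) \<nu> = expectation (\<lambda>\<omega>. P \<omega> * \<nu> (P \<omega>)) / \<mu>"
    using integral_given(1)[OF int] by (simp add: integral_distr[OF m] *)
  show "integral\<^sup>L (distr (given M A 0) borel P) \<nu> =
      (expectation (\<lambda>\<omega>. \<nu> (P \<omega>)) - expectation (\<lambda>\<omega>. P \<omega> * \<nu> (P \<omega>))) / (1 - \<mu>)"
    using integral_given(2)[OF int] by (simp add: integral_distr[OF m] *)
qed

theorem ACE_inequalities:
  assumes \<nu>1: "is_outcome_regression M A 1 P Y \<nu>1" "integrable (distr M borel P) \<nu>1"
    and \<nu>0: "is_outcome_regression M A 0 P Y \<nu>0" "integrable (distr M borel P) \<nu>0"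
    and le: "e1 \<le> m1" "e0 \<le> m0"
  shows "ACE1_adj M A P Y \<nu>0 \<ge> ACE_unadj M A Y \<and> ACE_unadj M A Y \<ge> ACE1_true M A Y1 Y0
    \<and> ACE0_adj M A P Y \<nu>1 \<ge> ACE_unadj M A Y \<and> ACE_unadj M A Y \<ge> ACE0_true M A Y1 Y0
    \<and> ACE_adj M P \<nu>1 \<nu>0 \<ge> ACE_unadj M A Y \<and> ACE_unadj M A Y \<ge> ACE_true M Y1 Y0"
proof -
  have [measurable]: "\<nu>1 \<in> borel_measurable borel" "\<nu>0 \<in> borel_measurable borel"
    using \<nu>1 \<nu>0 by (simp_all add: is_outcome_regression_def)
  have i: "integrable M (\<lambda>\<omega>. \<nu>1 (P \<omega>))" "integrable M (\<lambda>\<omega>. \<nu>0 (P \<omega>))"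
    using \<nu>1(2) \<nu>0(2) by (simp_all add: integrable_distr_eq)
  have r1: "AE \<omega> in M. \<nu>1 (P \<omega>) = m1" by (rule regression_1[OF \<nu>1(1) i(1)])
  have r0: "AE \<omega> in M. (1 - P \<omega>) * \<nu>0 (P \<omega>) = e0 - P \<omega> * m0" by (rule regression_0[OF \<nu>0(1) i(2)])
  define D where "D = m0 - e0"
  have D: "0 \<le> D" using le by (simp add: D_def)
  have E\<nu>1: "expectation (\<lambda>\<omega>. \<nu>1 (P \<omega>)) = m1"
    using integral_cong_AE[OF _ _ r1] by (simp add: prob_space)
  have "AE \<omega> in M. P \<omega> * \<nu>1 (P \<omega>) = P \<omega> * m1" using r1 by eventually_elim simp
  then have "expectation (\<lambda>\<omega>. P \<omega> * \<nu>1 (P \<omega>)) = expectation (\<lambda>\<omega>. P \<omega> * m1)"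
    by (intro integral_cong_AE) measurable
  then have EP\<nu>1: "expectation (\<lambda>\<omega>. P \<omega> * \<nu>1 (P \<omega>)) = \<mu> * m1"
    by (simp add: \<mu>_def)
  \<comment> \<open>This leaves the mean of \<open>\<nu>0 (P)\<close> as the only unknown, so one
    bound on it settles both \<open>ACE1_adj\<close> and \<open>ACE_adj\<close>.\<close>
  have "AE \<omega> in M. P \<omega> * \<nu>0 (P \<omega>) = \<nu>0 (P \<omega>) - e0 + P \<omega> * m0"
    using r0 by eventually_elim (simp add: algebra_simps)
  then have "expectation (\<lambda>\<omega>. P \<omega> * \<nu>0 (P \<omega>)) = expectation (\<lambda>\<omega>. \<nu>0 (P \<omega>) - e0 + P \<omega> * m0)"
    by (intro integral_cong_AE) measurable
  then have EP\<nu>0: "expectation (\<lambda>\<omega>. P \<omega> * \<nu>0 (P \<omega>)) = expectation (\<lambda>\<omega>. \<nu>0 (P \<omega>)) - e0 + \<mu> * m0"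
    using i P_int by (simp add: \<mu>_def prob_space)
  \<comment> \<open>Jensen's inequality for \<open>1 / (1 - p)\<close>, through the tangent line at \<open>\<mu>\<close>.\<close>
  have "AE \<omega> in M. \<nu>0 (P \<omega>) \<le> m0 - D * (1 / (1 - \<mu>) + (P \<omega> - \<mu>) / (1 - \<mu>)\<^sup>2)"
    using r0 P01
  proof eventually_elim
    case (elim \<omega>)
    have tangent: "1 / (1 - \<mu>) + (P \<omega> - \<mu>) / (1 - \<mu>)\<^sup>2 \<le> 1 / (1 - P \<omega>)"
      using inverse_tangent_le[of "1 - \<mu>" "1 - P \<omega>"] elim \<mu>_bounds by simp
    have "\<nu>0 (P \<omega>) = m0 - D * (1 / (1 - P \<omega>))"
      using elim by (simp add: D_def field_simps)
    with mult_left_mono[OF tangent D] show ?case by simp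
  qed
  then have "expectation (\<lambda>\<omega>. \<nu>0 (P \<omega>))
      \<le> expectation (\<lambda>\<omega>. m0 - D * (1 / (1 - \<mu>) + (P \<omega> - \<mu>) / (1 - \<mu>)\<^sup>2))"
    using i P_int by (intro integral_mono_AE) auto
  \<comment> \<open>The linear term of the tangent vanishes, as \<open>P\<close> has mean
    \<open>\<mu>\<close>. What remains is the mean of \<open>Y\<close> given \<open>A = 0\<close>,
    by \<open>given_Y\<close> and \<open>q\<close> below.\<close>
  also have "\<dots> = m0 - D / (1 - \<mu>)"
    using P_int by (simp add: prob_space \<mu>_def)
  finally have E\<nu>0: "expectation (\<lambda>\<omega>. \<nu>0 (P \<omega>)) \<le> m0 - D / (1 - \<mu>)" .
  note simps = ACE1_adj_def ACE0_adj_def ACE_adj_def ACE_unadj_def ACE1_true_def ACE0_true_def ACE_true_def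
    given_Y given_Y0 given_Y1 integral_distr_P i E\<nu>1 EP\<nu>1 EP\<nu>0 e1_def[symmetric] e0_def[symmetric]
  have q: "(e0 - \<mu> * m0) / (1 - \<mu>) = m0 - D / (1 - \<mu>)" "(e1 - \<mu> * m1) / (1 - \<mu>) = m1 - (m1 - e1) / (1 - \<mu>)"
    using \<mu>_bounds by (simp_all add: D_def field_simps)
  have D_le: "D \<le> D / (1 - \<mu>)" and "m1 - e1 \<le> (m1 - e1) / (1 - \<mu>)"
    using D le \<mu>_bounds by (simp_all add: pos_le_divide_eq mult_left_le)
  show ?thesis
  proof (intro conjI)
    have "(expectation (\<lambda>\<omega>. \<nu>0 (P \<omega>)) - e0 + \<mu> * m0) / \<mu> \<le> m0 - D / (1 - \<mu>)"
    proof -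
      have "expectation (\<lambda>\<omega>. \<nu>0 (P \<omega>)) - e0 + \<mu> * m0 \<le> \<mu> * (m0 - D / (1 - \<mu>))"
      proof -
        \<comment> \<open>After the bound on the mean of \<open>\<nu>0 (P)\<close> is inserted,
          \<open>m0 - e0\<close> becomes \<open>D\<close>, and this identity extracts the factor
          \<open>\<mu>\<close>.\<close>
        have "D - D / (1 - \<mu>) = - (\<mu> * (D / (1 - \<mu>)))" using \<mu>_bounds by (simp add: field_simps)
        then show ?thesis using E\<nu>0 by (simp add: D_def right_diff_distrib)
      qed
      then show ?thesis using \<mu>_bounds by (simp add: pos_divide_le_eq mult.commute)
    qed
    then show "ACE1_adj M A P Y \<nu>0 \<ge> ACE_unadj M A Y" by (simp add: simps q)
    show "ACE_unadj M A Y \<ge> ACE1_true M A Y1 Y0" using D D_le by (simp add: simps q)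
    \<comment> \<open>As \<open>\<nu>1 (P)\<close> is almost surely constant, this comparison is in
      fact an equality.\<close>
    have "(m1 - \<mu> * m1) / (1 - \<mu>) = m1" using \<mu>_bounds by (simp add: field_simps)
    then show "ACE0_adj M A P Y \<nu>1 \<ge> ACE_unadj M A Y" by (simp add: simps)
    show "ACE_unadj M A Y \<ge> ACE0_true M A Y1 Y0" using le \<mu>_bounds by (simp add: simps q)
    show "ACE_adj M P \<nu>1 \<nu>0 \<ge> ACE_unadj M A Y" using E\<nu>0 by (simp add: simps q)
    show "ACE_unadj M A Y \<ge> ACE_true M Y1 Y0" using D_le le by (simp add: simps q D_def)
  qed
qed

end

section \<open>From the causal diagram to the selection model\<close>

theorem theorem6:
  fixes M :: "'a measure" and N :: "'z measure"
    and Z :: "'a \<Rightarrow> 'z" and A P Y1 Y0 Y :: "'a \<Rightarrow> real"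
    and \<delta> \<eta> \<nu>1 \<nu>0 :: "real \<Rightarrow> real"
  assumes prob: "prob_space M"
    and Z: "Z \<in> M \<rightarrow>\<^sub>M N"
    and A: "A \<in> borel_measurable M" "\<And>\<omega>. \<omega> \<in> space M \<Longrightarrow> A \<omega> \<in> {0, 1}"
    and Y1: "integrable M Y1"
    and Y0: "integrable M Y0"
    and Y: "\<And>\<omega>. \<omega> \<in> space M \<Longrightarrow> Y \<omega> = A \<omega> * Y1 \<omega> + (1 - A \<omega>) * Y0 \<omega>"
    and P: "P \<in> borel_measurable M"
      "AE \<omega> in M. P \<omega> = pr_given M (gen_alg M Z N) {\<omega>\<in>space M. A \<omega> = 1} \<omega>"
    and indep: "prob_space.indep_set M
      (sets (gen_alg M Z N)) (sets (gen_alg M (\<lambda>\<omega>. (Y1 \<omega>, Y0 \<omega>)) borel))"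
    and cond_indep: "cond_indep M (gen_alg M (\<lambda>\<omega>. (P \<omega>, Y1 \<omega>, Y0 \<omega>)) borel) borel A N Z"
    and positivity: "AE \<omega> in M. 0 < P \<omega> \<and> P \<omega> < 1"
    and \<nu>1: "is_outcome_regression M A 1 P Y \<nu>1" "integrable (distr M borel P) \<nu>1"
    and \<nu>0: "is_outcome_regression M A 0 P Y \<nu>0" "integrable (distr M borel P) \<nu>0"
    and a': "AE \<omega> in M. pr_given M (gen_alg M (\<lambda>\<omega>. (P \<omega>, Y1 \<omega>, Y0 \<omega>)) borel)
        {\<omega>\<in>space M. A \<omega> = 1} \<omega> = P \<omega> * \<delta> (Y1 \<omega>) * \<eta> (Y0 \<omega>)"
      "mono \<delta>" "mono \<eta>" "AE \<omega> in M. 0 \<le> \<delta> (Y1 \<omega>) \<and> 0 \<le> \<eta> (Y0 \<omega>)"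
    and b: "nonneg_distr_assoc M Y0 Y1" "nonneg_distr_assoc M Y1 Y0"
    and c: "esssup_free_of M Y1 Y0" "esssup_free_of M Y0 Y1"
  shows "ACE1_adj M A P Y \<nu>0 \<ge> ACE_unadj M A Y \<and> ACE_unadj M A Y \<ge> ACE1_true M A Y1 Y0
    \<and> ACE0_adj M A P Y \<nu>1 \<ge> ACE_unadj M A Y \<and> ACE_unadj M A Y \<ge> ACE0_true M A Y1 Y0
    \<and> ACE_adj M P \<nu>1 \<nu>0 \<ge> ACE_unadj M A Y \<and> ACE_unadj M A Y \<ge> ACE_true M Y1 Y0"
proof -
  interpret prob_space M by (rule prob)
  have A_meas [measurable]: "A \<in> borel_measurable M" by (rule A(1))
  have P_meas [measurable]: "P \<in> borel_measurable M" by (rule P(1))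
  have Y_meas [measurable]: "Y1 \<in> borel_measurable M" "Y0 \<in> borel_measurable M" using Y1 Y0 by simp_all
  have [measurable]: "\<delta> \<in> borel_measurable borel" "\<eta> \<in> borel_measurable borel"
    using a'(2,3) by (auto intro: borel_measurable_mono)
  define g where "g u = \<delta> (fst u) * \<eta> (snd u)" for u
  define FZ where "FZ = gen_alg M Z N"
  define FU where "FU = gen_alg M (\<lambda>\<omega>. (Y1 \<omega>, Y0 \<omega>)) borel"
  define E where "E = {\<omega>\<in>space M. A \<omega> = 1}"
  \<comment> \<open>The version \<open>Q\<close> of the propensity is measurable with respect to
    \<open>Z\<close>, whereas \<open>P\<close> only equals it almost surely. Independence and test
    functions are handled through \<open>Q\<close> and then transferred to \<open>P\<close>.\<close>
  define Q where "Q = pr_given M FZ E"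
  have E: "E \<in> sets M" unfolding E_def by measurable
  have subZ: "subalgebra M FZ" unfolding FZ_def using Z by (rule subalgebra_gen_alg)
  have subU: "subalgebra M FU" unfolding FU_def by (rule subalgebra_gen_alg) measurable
  have U_FU: "(\<lambda>\<omega>. (Y1 \<omega>, Y0 \<omega>)) \<in> borel_measurable FU"
    unfolding FU_def by (rule measurable_gen_alg) measurable
  have Q_FZ: "Q \<in> borel_measurable FZ" unfolding Q_def pr_given_def by (rule borel_measurable_cond_exp)
  then have [measurable]: "Q \<in> borel_measurable M" by (rule measurable_from_subalg[OF subZ])
  have PQ: "AE \<omega> in M. P \<omega> = Q \<omega>" using P(2) by (simp add: Q_def FZ_def E_def)
  have QP: "AE \<omega> in M. Q \<omega> = P \<omega>" using PQ by eventually_elim simp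
  interpret observed_selection_model M A P Y1 Y0 g Y
  proof unfold_locales
    show "g \<in> borel_measurable borel" unfolding g_def by measurable
    show "AE \<omega> in M. 0 \<le> g (Y1 \<omega>, Y0 \<omega>)"
      using a'(4) by eventually_elim (simp add: g_def)
    show "AE \<omega> in M. pr_given M (gen_alg M (\<lambda>\<omega>. (P \<omega>, Y1 \<omega>, Y0 \<omega>)) borel)
        {\<omega>\<in>space M. A \<omega> = 1} \<omega> = P \<omega> * g (Y1 \<omega>, Y0 \<omega>)"
      using a'(1) by (simp add: g_def mult.assoc)
    show "indep_var borel P borel (\<lambda>\<omega>. \<phi> (Y1 \<omega>, Y0 \<omega>))"
      if "\<phi> \<in> borel_measurable borel" for \<phi> :: "real \<times> real \<Rightarrow> real"
      by (rule indep_var_cong_AE[OF indep_var_subalgebra[OF indep[folded FZ_def FU_def] subZ subU Q_FZ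
            measurable_compose[OF U_FU that]] P_meas QP])
    \<comment> \<open>The tower property requires a test function of \<open>Z\<close>, hence the
      detour through \<open>f (Q)\<close>.\<close>
    show "expectation (\<lambda>\<omega>. f (P \<omega>) * A \<omega>) = expectation (\<lambda>\<omega>. f (P \<omega>) * P \<omega>)"
      if [measurable]: "f \<in> borel_measurable borel" and f: "integrable M (\<lambda>\<omega>. f (P \<omega>))" for f :: "real \<Rightarrow> real"
    proof -
      have fAE: "AE \<omega> in M. f (P \<omega>) * indicator E \<omega> = f (Q \<omega>) * indicator E \<omega>"
        using PQ by eventually_elim simp
      have fPE: "integrable M (\<lambda>\<omega>. f (P \<omega>) * indicator E \<omega>)"
        using f E by (rule integrable_real_mult_indicator[rotated])
      have fQE: "integrable M (\<lambda>\<omega>. f (Q \<omega>) * indicator E \<omega>)"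
        by (rule integrable_cong_AE_imp[OF fPE _ fAE]) (use E in measurable)
      have "expectation (\<lambda>\<omega>. f (P \<omega>) * A \<omega>) = expectation (\<lambda>\<omega>. f (P \<omega>) * indicator E \<omega>)"
        by (rule Bochner_Integration.integral_cong[OF refl]) (use A(2) in \<open>auto simp: E_def indicator_def\<close>)
      also have "\<dots> = expectation (\<lambda>\<omega>. f (Q \<omega>) * indicator E \<omega>)"
        using fAE by (intro integral_cong_AE) (use E in measurable)
      also have "\<dots> = expectation (\<lambda>\<omega>. f (Q \<omega>) * P \<omega>)"
        by (rule expectation_mult_pr_given(2)[OF subZ _ E P_meas QP[unfolded Q_def] fQE, symmetric])
          (rule measurable_compose[OF Q_FZ that(1)])
      also have "\<dots> = expectation (\<lambda>\<omega>. f (P \<omega>) * P \<omega>)"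
        using PQ by (intro integral_cong_AE) (auto elim: eventually_mono)
      finally show ?thesis .
    qed
  qed (use A Y1 Y0 Y positivity in \<open>simp_all\<close>)
  obtain C where "AE \<omega> in M. g (Y1 \<omega>, Y0 \<omega>) \<le> C" by (rule g_bounded)
  then have C: "AE \<omega> in M. \<delta> (Y1 \<omega>) * \<eta> (Y0 \<omega>) \<le> C" by (simp add: g_def)
  then have C': "AE \<omega> in M. \<eta> (Y0 \<omega>) * \<delta> (Y1 \<omega>) \<le> C" by (simp only: mult.commute)
  have nonneg: "AE \<omega> in M. 0 \<le> \<eta> (Y0 \<omega>) \<and> 0 \<le> \<delta> (Y1 \<omega>)"
    using a'(4) by eventually_elim simp
  have g1: "expectation (\<lambda>\<omega>. \<delta> (Y1 \<omega>) * \<eta> (Y0 \<omega>)) = 1" using expectation_g by (simp add: g_def)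
  \<comment> \<open>The factor \<open>E g = 1\<close> turns the covariance inequality into a
    comparison of means.\<close>
  have "e1 \<le> m1"
    using expectation_mult_assoc[OF Y1 Y_meas(2) b(2) a'(2,3,4) C] g1
    by (simp add: e1_def m1_def g_def mult.commute)
  moreover have "e0 \<le> m0"
    using expectation_mult_assoc[OF Y0 Y_meas(1) b(1) a'(3,2) nonneg C'] g1
    by (simp add: e0_def m0_def g_def mult.commute)
  ultimately show ?thesis
    by (rule ACE_inequalities[OF \<nu>1 \<nu>0])
qed

end
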